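(* Consider the setting of the following depth-$2l$ reconstruction. The target network is an arbitrary $$g(x)=\Gamma_l^*W_l^*\,\mathrm{ReLU}\big(\cdots\mathrm{ReLU}(\Gamma_1^*W_1^*x+\beta_1^* )\cdots\big)+\beta_l^*,$$ with $x\in\mathbb{R}^d$, $W_i^*\in\mathbb{R}^{d\times d}$, $\|W_i^*\|\le1$, $\Gamma_i^*$ diagonal $d\times d$, and $\beta_i^*\in\mathbb{R}^d$. The reconstructing network is $$f(x)=\Gamma_{2l}W_{2l}\,\mathrm{ReLU}\big(\cdots\mathrm{ReLU}(\Gamma_1W_1x+\beta_1)\cdots\big)+\beta_{2l},$$ with the following dimensions: - for odd $i$: $W_i\in\mathbb{R}^{d^2\times d}$, $\Gamma_i$ diagonal $d^2\times d^2$, $\beta_i\in\mathbb{R}^{d^2}$; - for even $i$: $W_i\in\mathbb{R}^{d\times d^2}$, $\Gamma_i$ diagonal $d\times d$, $\beta_i\in\mathbb{R}^d$. Suppose each frozen weight matrix is random and sparse: $W_i=\widetilde W_i\circ M_i$. Here $\widetilde W_i$ has i.i.d. entries from a continuous bounded distribution, $M_i$ has i.i.d. $\mathrm{Bern}(p)$ entries, and all these matrices are mutually independent. Then for every $a>0$ there is a constant $C>0$ such that, for all sufficiently large $d$, the following holds. If $l\le d^a$ and $C\sqrt{\log d/d}\le p\le1$, then with probability at least $1-1/d$ there exist diagonal $\Gamma_1,\dots,\Gamma_{2l}$ and vectors $\beta_1,\dots,\beta_{2l}$ such that $f(x)=g(x)$ for all $\|x\|_2\le1$.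
   Context: $\mathrm{ReLU}(t)=\max(t,0)$ is applied entrywise. $\circ$ denotes the Hadamard (entrywise) product. $\mathrm{Bern}(p)$ is the distribution on $\{0,1\}$ with $\mathbb{P}(1)=p$. The $\Gamma_i$ (diagonal) and $\beta_i$ are the tunable normalization-layer scale and shift parameters; the $W_i$ are frozen. *)

theory Defs
  imports "HOL-Probability.Probability"
begin

text \<open>Vectors are functions nat => real, meaningful on indices below the
dimension; matrices are nat => nat => real (row, column). A diagonal matrix
Gamma is represented by its diagonal (a vector).\<close>

definition relu :: "(nat \<Rightarrow> real) \<Rightarrow> (nat \<Rightarrow> real)" where
  "relu z = (\<lambda>r. max (z r) 0)"

text \<open>Affine normalized layer k (1-based): input dimension n (k-1), output
dimension n k; z |-> Gamma_k W_k z + beta_k.\<close>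
definition aff ::
  "(nat \<Rightarrow> nat) \<Rightarrow> (nat \<Rightarrow> nat \<Rightarrow> nat \<Rightarrow> real) \<Rightarrow> (nat \<Rightarrow> nat \<Rightarrow> real) \<Rightarrow>
   (nat \<Rightarrow> nat \<Rightarrow> real) \<Rightarrow> nat \<Rightarrow> (nat \<Rightarrow> real) \<Rightarrow> (nat \<Rightarrow> real)" where
  "aff n W \<gamma> \<beta> k z = (\<lambda>r. \<gamma> k r * (\<Sum>c<n (k - 1). W k r c * z c) + \<beta> k r)"

fun netEval ::
  "(nat \<Rightarrow> nat) \<Rightarrow> (nat \<Rightarrow> nat \<Rightarrow> nat \<Rightarrow> real) \<Rightarrow> (nat \<Rightarrow> nat \<Rightarrow> real) \<Rightarrow>
   (nat \<Rightarrow> nat \<Rightarrow> real) \<Rightarrow> nat \<Rightarrow> (nat \<Rightarrow> real) \<Rightarrow> (nat \<Rightarrow> real)" where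
  "netEval n W \<gamma> \<beta> 0 x = x"
| "netEval n W \<gamma> \<beta> (Suc k) x =
     aff n W \<gamma> \<beta> (Suc k) (if k = 0 then x else relu (netEval n W \<gamma> \<beta> k x))"

definition recDim :: "nat \<Rightarrow> nat \<Rightarrow> nat" where
  "recDim d k = (if k = 0 then d else if odd k then d ^ 2 else d)"

definition opnorm_le1 :: "nat \<Rightarrow> (nat \<Rightarrow> nat \<Rightarrow> real) \<Rightarrow> bool" where
  "opnorm_le1 d A \<longleftrightarrow>
     (\<forall>z. sqrt (\<Sum>r<d. (\<Sum>c<d. A r c * z c)^2) \<le> sqrt (\<Sum>c<d. (z c)^2))"

definition Bern :: "real \<Rightarrow> real measure" where
  "Bern p = distr (measure_pmf (bernoulli_pmf p)) borel (\<lambda>b. if b then 1 else 0)"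

definition Idx :: "nat \<Rightarrow> nat \<Rightarrow> (nat \<times> nat \<times> nat) set" where
  "Idx d l = {(i, r, c). 1 \<le> i \<and> i \<le> 2 * l \<and> r < recDim d i \<and> c < recDim d (i - 1)}"

text \<open>Sample space: for every entry an independent pair (Wtilde entry, mask entry),
with Wtilde entry ~ D and mask entry ~ Bern(p).\<close>
definition Omega :: "real measure \<Rightarrow> nat \<Rightarrow> nat \<Rightarrow> real \<Rightarrow> (nat \<times> nat \<times> nat \<Rightarrow> real \<times> real) measure" where
  "Omega D d l p = (\<Pi>\<^sub>M e\<in>Idx d l. D \<Otimes>\<^sub>M Bern p)"

definition Wrand :: "(nat \<times> nat \<times> nat \<Rightarrow> real \<times> real) \<Rightarrow> nat \<Rightarrow> nat \<Rightarrow> nat \<Rightarrow> real" where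
  "Wrand \<omega> i r c = fst (\<omega> (i, r, c)) * snd (\<omega> (i, r, c))"

end

theory Submission
  imports Defs "Jordan_Normal_Form.Determinant"
begin

text \<open>With large shifts the ReLU of every odd layer is the identity on the bounded set of
  relevant inputs, so layers \<open>2k - 1\<close> and \<open>2k\<close> reproduce layer \<open>k\<close> of the target as soon as
  \<open>A diag(g) B = W\<^sub>k\<^sup>*\<close> is solvable for \<open>g\<close>, where \<open>A = W\<^bsub>2k\<^esub>\<close> and \<open>B = W\<^bsub>2k-1\<^esub>\<close>. This is a square
  linear system whose \<open>m\<close>-th column is the tensor product of column \<open>m\<close> of \<open>A\<close> and row \<open>m\<close> of
  \<open>B\<close>. Its determinant is a sum of distinct square-free monomials, one per bijection
  \<open>m \<mapsto> (i, j)\<close>, hence almost surely nonzero once one bijection has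
  \<open>A\<^sub>i\<^sub>m \<noteq> 0\<close> and \<open>B\<^sub>m\<^sub>j \<noteq> 0\<close> throughout. Such a bijection is assembled from \<open>2d\<close> perfect matchings in
  random bipartite \<open>d \<times> d\<close> graphs of edge density \<open>p\<close>, which exist with high probability by Hall's
  theorem and a union bound.\<close>

section \<open>Perfect matchings\<close>

text \<open>Induction on the size of \<open>A\<close>. If every nonempty proper subset has a surplus
  of neighbours, any single element can be matched and its partner deleted. Otherwise a proper
  subset \<open>X0\<close> without surplus is matched inside its neighbourhood and the remainder
  outside it.\<close>

lemma hall_marriage:
  fixes N :: "'a \<Rightarrow> 'b set"
  assumes "finite A" and "\<And>a. a \<in> A \<Longrightarrow> finite (N a)"
    and "\<And>X. X \<subseteq> A \<Longrightarrow> card X \<le> card (\<Union>(N ` X))"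
  shows "\<exists>f. inj_on f A \<and> (\<forall>a\<in>A. f a \<in> N a)"
  using assms
proof (induction "card A" arbitrary: A N rule: less_induct)
  case less
  note fin = less.prems(1) and finN = less.prems(2) and hall = less.prems(3)
  consider "A = {}"
    | "A \<noteq> {}" "\<And>X. X \<subset> A \<Longrightarrow> X \<noteq> {} \<Longrightarrow> card X < card (\<Union>(N ` X))"
    | X0 where "X0 \<subset> A" "X0 \<noteq> {}" "card (\<Union>(N ` X0)) \<le> card X0"
    by (meson linorder_not_le)
  then show ?case
  proof cases
    case 1
    then show ?thesis by simp
  next
    case 2
    then obtain a where a: "a \<in> A" by auto
    have "card {a} \<le> card (\<Union>(N ` {a}))" using hall[of "{a}"] a by auto
    then obtain b where b: "b \<in> N a" by (cases "N a = {}") auto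
    have "\<exists>f. inj_on f (A - {a}) \<and> (\<forall>x\<in>A - {a}. f x \<in> N x - {b})"
    proof (rule less.hyps)
      show "card (A - {a}) < card A" using a fin by (meson card_Diff1_less)
      show "finite (A - {a})" using fin by simp
      show "finite (N x - {b})" if "x \<in> A - {a}" for x using finN that by auto
      show "card X \<le> card (\<Union>x\<in>X. N x - {b})" if X: "X \<subseteq> A - {a}" for X
      proof (cases "X = {}")
        case False
        \<comment> \<open>The strict surplus pays for the loss of \<open>b\<close>.\<close>
        have "card X < card (\<Union>(N ` X))" using 2(2)[of X] X a False by blast
        moreover have "(\<Union>x\<in>X. N x - {b}) = \<Union>(N ` X) - {b}" by auto
        moreover have "card (\<Union>(N ` X)) - 1 \<le> card (\<Union>(N ` X) - {b})"
          by (metis card_Diff_singleton_if diff_le_self le_refl)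
        ultimately show ?thesis by simp
      qed simp
    qed
    then obtain f where f: "inj_on f (A - {a})" "\<forall>x\<in>A - {a}. f x \<in> N x - {b}" by blast
    have "inj_on (f(a := b)) A" using f unfolding inj_on_def by auto
    moreover have "\<forall>x\<in>A. (f(a := b)) x \<in> N x" using f b by auto
    ultimately show ?thesis by blast
  next
    case 3
    let ?U = "\<Union>(N ` X0)"
    have finX: "finite X0" using 3 fin by (meson finite_subset psubset_imp_subset)
    have finU: "finite ?U" using finX finN 3 by auto
    have "\<exists>f. inj_on f X0 \<and> (\<forall>x\<in>X0. f x \<in> N x)"
    proof (rule less.hyps)
      show "card X0 < card A" using 3 fin by (intro psubset_card_mono) auto
      show "finite (N x)" if "x \<in> X0" for x using finN 3 that by auto
      show "card X \<le> card (\<Union>(N ` X))" if "X \<subseteq> X0" for X using hall[of X] 3 that by auto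
    qed (rule finX)
    then obtain f where f: "inj_on f X0" "\<forall>x\<in>X0. f x \<in> N x" by blast
    have "\<exists>g. inj_on g (A - X0) \<and> (\<forall>x\<in>A - X0. g x \<in> N x - ?U)"
    proof (rule less.hyps)
      show "card (A - X0) < card A" using 3 fin by (intro psubset_card_mono) auto
      show "finite (A - X0)" using fin by simp
      show "finite (N x - ?U)" if "x \<in> A - X0" for x using finN that by auto
      show "card X \<le> card (\<Union>x\<in>X. N x - ?U)" if X: "X \<subseteq> A - X0" for X
      proof -
        have finX': "finite X" using X fin finite_subset by auto
        \<comment> \<open>Hall's condition for the union, less the at most \<open>card X0\<close>
          neighbours of \<open>X0\<close>, leaves enough for \<open>X\<close>.\<close>
        have "card X + card X0 = card (X \<union> X0)"
          using X finX finX' by (intro card_Un_disjoint[symmetric]) auto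
        also have "\<dots> \<le> card (\<Union>(N ` (X \<union> X0)))" using hall[of "X \<union> X0"] X 3 by auto
        also have "\<Union>(N ` (X \<union> X0)) = (\<Union>x\<in>X. N x - ?U) \<union> ?U" by auto
        also have "card \<dots> \<le> card (\<Union>x\<in>X. N x - ?U) + card ?U" by (rule card_Un_le)
        finally show ?thesis using 3 by simp
      qed
    qed
    then obtain g where g: "inj_on g (A - X0)" "\<forall>x\<in>A - X0. g x \<in> N x - ?U" by blast
    let ?h = "\<lambda>x. if x \<in> X0 then f x else g x"
    have "inj_on ?h A"
    proof (rule inj_onI)
      fix x y assume xy: "x \<in> A" "y \<in> A" "?h x = ?h y"
      have mix: False if "u \<in> X0" "v \<in> A - X0" "f u = g v" for u v
        using that f(2) g(2) by (metis DiffD2 UN_I)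
      show "x = y"
        using xy mix[of x y] mix[of y x] f(1) g(1)
        by (auto split: if_splits dest: inj_onD)
    qed
    moreover have "\<forall>x\<in>A. ?h x \<in> N x" using f(2) g(2) by auto
    ultimately show ?thesis by blast
  qed
qed

text \<open>Candidate violators of Hall's condition: if no edge joins \<open>X\<close> and
  \<open>Y\<close>, then \<open>X\<close> has at most \<open>d - card Y = card X - 1\<close>
  neighbours. The absence of edges is kept out of the definition so that the union bound runs over a
  deterministic set.\<close>

definition blockers :: "nat \<Rightarrow> (nat set \<times> nat set) set" where
  "blockers d = {(X, Y). X \<subseteq> {..<d} \<and> Y \<subseteq> {..<d} \<and> card X + card Y = d + 1}"

lemma finite_blockers [simp]: "finite (blockers d)"
  by (rule finite_subset[of _ "Pow {..<d} \<times> Pow {..<d}"]) (auto simp: blockers_def)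

text \<open>If \<open>X\<close> violates Hall's condition, at least \<open>d + 1 - card X\<close>
  vertices lie outside its neighbourhood; a subset of exactly this size forms an edgeless blocker
  with \<open>X\<close>.\<close>

lemma matching_or_blocker:
  assumes "\<And>X Y. (X, Y) \<in> blockers d \<Longrightarrow> \<exists>x\<in>X. \<exists>y\<in>Y. R x y"
  shows "\<exists>\<sigma>. bij_betw \<sigma> {..<d} {..<d} \<and> (\<forall>i<d. R i (\<sigma> i))"
proof -
  define N where "N i = {j. j < d \<and> R i j}" for i
  have "\<exists>f. inj_on f {..<d} \<and> (\<forall>a\<in>{..<d}. f a \<in> N a)"
  proof (rule hall_marriage)
    show "finite (N a)" for a by (simp add: N_def)
    show "card X \<le> card (\<Union>(N ` X))" if X: "X \<subseteq> {..<d}" for X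
    proof (rule ccontr)
      assume less: "\<not> card X \<le> card (\<Union>(N ` X))"
      have cX: "card X \<le> d" using card_mono[OF _ X] by simp
      have "card ({..<d} - \<Union>(N ` X)) = d - card (\<Union>(N ` X))"
        by (subst card_Diff_subset) (auto simp: N_def intro: finite_subset[of _ "{..<d}"])
      then have "d + 1 - card X \<le> card ({..<d} - \<Union>(N ` X))" using less by linarith
      then obtain Y where Y: "Y \<subseteq> {..<d} - \<Union>(N ` X)" "card Y = d + 1 - card X"
        by (meson obtain_subset_with_card_n)
      then have "(X, Y) \<in> blockers d" using X cX by (auto simp: blockers_def)
      then obtain x y where "x \<in> X" "y \<in> Y" "R x y" using assms by blast
      then show False using Y by (auto simp: N_def)
    qed
  qed simp
  then obtain f where f: "inj_on f {..<d}" "\<forall>a\<in>{..<d}. f a \<in> N a" by blast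
  then have "f ` {..<d} \<subseteq> {..<d}" by (auto simp: N_def)
  then have "bij_betw f {..<d} {..<d}"
    using f(1) by (simp add: bij_betw_def endo_inj_surj)
  then show ?thesis using f(2) by (auto simp: N_def)
qed

section \<open>Counting blockers for the union bound\<close>

text \<open>Symmetry turns the second coefficient into \<open>d choose (s - 1)\<close>, so the
  exponent stays proportional to \<open>s\<close> even when \<open>d + 1 - s\<close> is
  large.\<close>

lemma choose_product_le:
  assumes "1 \<le> s" "s \<le> d"
  shows "(d choose s) * (d choose (d + 1 - s)) \<le> (d\<^sup>2) ^ s"
proof -
  have "d choose (d + 1 - s) = d choose (s - 1)"
    using assms by (subst binomial_symmetric) auto
  also have "\<dots> \<le> d ^ (s - 1)" using assms by (intro binomial_le_pow) auto
  also have "\<dots> \<le> d ^ s" using assms by (intro power_increasing) auto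
  finally have "d choose (d + 1 - s) \<le> d ^ s" .
  moreover have "d choose s \<le> d ^ s" using assms by (intro binomial_le_pow) auto
  ultimately have "(d choose s) * (d choose (d + 1 - s)) \<le> d ^ s * d ^ s"
    by (intro mult_mono) auto
  then show ?thesis by (simp add: power2_eq_square power_mult_distrib)
qed

text \<open>With \<open>s\<close> the smaller side, the other is at least \<open>d / 2\<close>, so
  the term is at most the \<open>s\<close>-th power of
  \<open>(real d)\<^sup>2 * exp (- t * d / 2)\<close>. This base is at most 1 and hence bounds its
  own powers.\<close>

lemma blocker_term_le:
  fixes q t :: real
  assumes q: "0 \<le> q" "q \<le> exp (- t)" and t: "0 \<le> t"
    and small: "(real d)\<^sup>2 * exp (- t * d / 2) \<le> 1"
    and s: "1 \<le> s" "2 * s \<le> d + 1"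
  shows "real ((d choose s) * (d choose (d + 1 - s))) * q ^ (s * (d + 1 - s))
         \<le> (real d)\<^sup>2 * exp (- t * d / 2)"
proof -
  let ?x = "(real d)\<^sup>2 * exp (- t * d / 2)"
  have sd: "s \<le> d" using s by linarith
  have "real d / 2 \<le> real (d + 1 - s)" using s by linarith
  then have "real s * (real d / 2) \<le> real s * real (d + 1 - s)" by (intro mult_left_mono) auto
  then have e: "t * (real s * (real d / 2)) \<le> t * real (s * (d + 1 - s))"
    using t by (intro mult_left_mono) auto
  have "q ^ (s * (d + 1 - s)) \<le> exp (- t) ^ (s * (d + 1 - s))"
    using q by (intro power_mono) auto
  also have "\<dots> = exp (- (t * real (s * (d + 1 - s))))"
    by (subst exp_of_nat_mult[symmetric]) (simp add: mult.commute)
  also have "\<dots> \<le> exp (- (t * (real s * (real d / 2))))" using e by simp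
  also have "\<dots> = exp (- t * d / 2) ^ s"
    by (subst exp_of_nat_mult[symmetric]) (simp add: mult_ac)
  finally have "q ^ (s * (d + 1 - s)) \<le> exp (- t * d / 2) ^ s" .
  moreover have "real ((d choose s) * (d choose (d + 1 - s))) \<le> ((real d)\<^sup>2) ^ s"
    using choose_product_le[OF s(1) sd] by (metis of_nat_le_iff of_nat_power)
  ultimately have "real ((d choose s) * (d choose (d + 1 - s))) * q ^ (s * (d + 1 - s))
      \<le> ((real d)\<^sup>2) ^ s * exp (- t * d / 2) ^ s"
    using q by (intro mult_mono) auto
  also have "\<dots> = ?x ^ s" by (simp add: power_mult_distrib)
  also have "\<dots> \<le> ?x ^ 1" using small s by (intro power_decreasing) auto
  finally show ?thesis by simp
qed

text \<open>\<open>q ^ (card X * card Y)\<close> is the chance that all entries of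
  \<open>X \<times> Y\<close> vanish when each does so independently with probability
  \<open>q\<close>. Neither side exceeds \<open>d\<close>, so \<open>card X\<close> ranges over
  \<open>1\<close> to \<open>d\<close>, which costs one factor \<open>d\<close> over the bound for a
  fixed size.\<close>

lemma blockers_weight_le:
  fixes q t :: real
  assumes q: "0 \<le> q" "q \<le> exp (- t)" and t: "0 \<le> t"
    and small: "(real d)\<^sup>2 * exp (- t * d / 2) \<le> 1"
  shows "(\<Sum>(X, Y)\<in>blockers d. q ^ (card X * card Y)) \<le> real d ^ 3 * exp (- t * d / 2)"
proof -
  let ?B = "\<lambda>k. {X. X \<subseteq> {..<d} \<and> card X = k} \<times> {Y. Y \<subseteq> {..<d} \<and> card Y = d + 1 - k}"
  have sub: "card X \<le> d" if "X \<subseteq> {..<d}" for X using card_mono[OF _ that] by simp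
  have fin: "finite (?B k)" for k by (intro finite_cartesian_product) auto
  have "blockers d = (\<Union>k\<in>{1..d}. ?B k)"
  proof (intro subset_antisym subsetI)
    fix z assume z: "z \<in> blockers d"
    obtain X Y where "z = (X, Y)" by (cases z)
    then show "z \<in> (\<Union>k\<in>{1..d}. ?B k)"
      using z sub[of X] sub[of Y] by (auto simp: blockers_def)
  qed (auto simp: blockers_def)
  then have "(\<Sum>(X, Y)\<in>blockers d. q ^ (card X * card Y))
      = (\<Sum>k\<in>{1..d}. \<Sum>(X, Y)\<in>?B k. q ^ (card X * card Y))"
    using fin by (simp only:, subst sum.UNION_disjoint) auto
  also have "\<dots> = (\<Sum>k\<in>{1..d}. real ((d choose k) * (d choose (d + 1 - k))) * q ^ (k * (d + 1 - k)))"
  proof (rule sum.cong[OF refl])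
    fix k
    have "(\<Sum>(X, Y)\<in>?B k. q ^ (card X * card Y)) = (\<Sum>z\<in>?B k. q ^ (k * (d + 1 - k)))"
      by (intro sum.cong) auto
    also have "\<dots> = real (card (?B k)) * q ^ (k * (d + 1 - k))" by simp
    also have "card (?B k) = (d choose k) * (d choose (d + 1 - k))"
      by (simp only: card_cartesian_product n_subsets[OF finite_lessThan] card_lessThan)
    finally show "(\<Sum>(X, Y)\<in>?B k. q ^ (card X * card Y))
      = real ((d choose k) * (d choose (d + 1 - k))) * q ^ (k * (d + 1 - k))" .
  qed
  also have "\<dots> \<le> (\<Sum>k\<in>{1..d}. (real d)\<^sup>2 * exp (- t * d / 2))"
  proof (rule sum_mono)
    fix k assume k: "k \<in> {1..d}"
    show "real ((d choose k) * (d choose (d + 1 - k))) * q ^ (k * (d + 1 - k))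
      \<le> (real d)\<^sup>2 * exp (- t * d / 2)"
    proof (cases "2 * k \<le> d + 1")
      case True
      then show ?thesis using blocker_term_le[OF assms] k by simp
    next
      case False
      \<comment> \<open>The term is symmetric under \<open>k \<mapsto> d + 1 - k\<close>, which
        brings the smaller side first.\<close>
      then show ?thesis using blocker_term_le[OF assms, of "d + 1 - k"] k by (simp add: mult_ac)
    qed
  qed
  also have "\<dots> = real d ^ 3 * exp (- t * d / 2)"
    by (simp add: power3_eq_cube power2_eq_square)
  finally show ?thesis .
qed

section \<open>Linearizing the hidden layers\<close>

text \<open>A nonzero determinant makes the matrix a unit, and its inverse applied to
  \<open>t\<close> is a solution. The sums match the encoding of weight matrices as
  functions.\<close>

lemma linear_system_solvable:
  fixes K :: "nat \<Rightarrow> nat \<Rightarrow> real"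
  assumes "det (mat n n (\<lambda>(i, j). K i j)) \<noteq> 0"
  shows "\<exists>v. \<forall>i<n. (\<Sum>j<n. K i j * v j) = t i"
proof -
  let ?A = "mat n n (\<lambda>(i, j). K i j)"
  have "?A \<in> Units (ring_mat TYPE(real) n ())"
    by (rule det_non_zero_imp_unit) (use assms in auto)
  then obtain B where B: "B \<in> carrier_mat n n" "?A * B = 1\<^sub>m n"
    unfolding Units_def ring_mat_def by auto
  define v where "v = B *\<^sub>v vec n t"
  have v: "v \<in> carrier_vec n" using B by (auto simp: v_def)
  have "?A *\<^sub>v v = (?A * B) *\<^sub>v vec n t"
    unfolding v_def by (rule assoc_mult_mat_vec[symmetric, of _ n n _ n]) (use B in auto)
  then have Av: "?A *\<^sub>v v = vec n t" using B by simp
  have "(\<Sum>j<n. K i j * v $ j) = t i" if "i < n" for i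
  proof -
    have "t i = (?A *\<^sub>v v) $ i" using that Av by simp
    also have "\<dots> = (\<Sum>j\<in>{0..<n}. K i j * v $ j)"
      using that v by (simp add: scalar_prod_def)
    finally show ?thesis by (simp add: atLeast0LessThan)
  qed
  then show ?thesis by blast
qed

text \<open>A sufficiently large shift makes the hidden ReLU act as the identity on the
  bounded set of inputs, so the two layers collapse to an affine map.\<close>
lemma linearized_layer_pair:
  fixes A B V :: "nat \<Rightarrow> nat \<Rightarrow> real"
  assumes "\<And>i j. i < d \<Longrightarrow> j < d \<Longrightarrow> (\<Sum>m<N. A i m * g m * B m j) = V i j"
  shows "\<exists>b1 b2. \<forall>z. (\<forall>c<d. \<bar>z c\<bar> \<le> Z) \<longrightarrow> (\<forall>r<d.
           \<delta> r * (\<Sum>m<N. A r m * relu (\<lambda>m. g m * (\<Sum>c<d. B m c * z c) + b1 m) m) + b2 r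
           = \<delta> r * (\<Sum>c<d. V r c * z c) + b r)"
proof -
  define b1 where "b1 m = \<bar>g m\<bar> * (\<Sum>c<d. \<bar>B m c\<bar> * Z)" for m
  \<comment> \<open>The shift \<open>b1\<close> passes through the second layer as a constant;
    \<open>b2\<close> cancels it after scaling by \<open>\<delta>\<close>.\<close>
  define b2 where "b2 r = b r - \<delta> r * (\<Sum>m<N. A r m * b1 m)" for r
  have "\<delta> r * (\<Sum>m<N. A r m * relu (\<lambda>m. g m * (\<Sum>c<d. B m c * z c) + b1 m) m) + b2 r
        = \<delta> r * (\<Sum>c<d. V r c * z c) + b r"
    if z: "\<forall>c<d. \<bar>z c\<bar> \<le> Z" and r: "r < d" for z r
  proof -
    have nonneg: "0 \<le> g m * (\<Sum>c<d. B m c * z c) + b1 m" for m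
    proof -
      have "\<bar>\<Sum>c<d. B m c * z c\<bar> \<le> (\<Sum>c<d. \<bar>B m c * z c\<bar>)" by (rule sum_abs)
      also have "\<dots> \<le> (\<Sum>c<d. \<bar>B m c\<bar> * Z)"
        using z by (intro sum_mono) (auto simp: abs_mult intro!: mult_left_mono)
      finally have "\<bar>g m * (\<Sum>c<d. B m c * z c)\<bar> \<le> b1 m"
        unfolding b1_def abs_mult by (intro mult_left_mono) auto
      then show ?thesis by linarith
    qed
    have "(\<Sum>m<N. A r m * relu (\<lambda>m. g m * (\<Sum>c<d. B m c * z c) + b1 m) m)
        = (\<Sum>m<N. A r m * (g m * (\<Sum>c<d. B m c * z c))) + (\<Sum>m<N. A r m * b1 m)"
      unfolding relu_def using nonneg by (simp add: max_absorb1 sum.distrib[symmetric] distrib_left)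
    also have "(\<Sum>m<N. A r m * (g m * (\<Sum>c<d. B m c * z c)))
        = (\<Sum>m<N. \<Sum>c<d. A r m * g m * B m c * z c)"
      by (simp add: sum_distrib_left mult_ac)
    also have "\<dots> = (\<Sum>c<d. (\<Sum>m<N. A r m * g m * B m c) * z c)"
      by (subst sum.swap) (simp add: sum_distrib_right)
    also have "\<dots> = (\<Sum>c<d. V r c * z c)" using assms r by simp
    finally show ?thesis by (simp add: b2_def distrib_left)
  qed
  then show ?thesis by blast
qed

text \<open>The input of layer \<open>Suc k\<close>. It absorbs the exception that the first layer
  receives \<open>x\<close> without a ReLU, so that one equation describes all layers.\<close>

definition layer_input where
  "layer_input n W \<gamma> \<beta> k x = (if k = 0 then x else relu (netEval n W \<gamma> \<beta> k x))"

lemma netEval_Suc_layer_input: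
  "netEval n W \<gamma> \<beta> (Suc k) x r
   = \<gamma> (Suc k) r * (\<Sum>c<n k. W (Suc k) r c * layer_input n W \<gamma> \<beta> k x c) + \<beta> (Suc k) r"
  by (simp add: aff_def layer_input_def)

text \<open>Supplies the bound from which the shifts are chosen. Inductively, an affine map keeps
  each coordinate bounded, a maximum over the \<open>d\<close> rows makes the bound uniform, and
  ReLU does not increase absolute values.\<close>

lemma layer_input_bounded:
  "\<exists>Z. \<forall>x. (\<Sum>c<d. (x c)\<^sup>2) \<le> 1 \<longrightarrow> (\<forall>c<d. \<bar>layer_input (\<lambda>_. d) W \<gamma> \<beta> k x c\<bar> \<le> Z)"
proof (induction k)
  case 0
  have "\<bar>x c\<bar> \<le> 1" if "(\<Sum>c<d. (x c)\<^sup>2) \<le> 1" "c < d" for x :: "nat \<Rightarrow> real" and c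
  proof -
    have "(x c)\<^sup>2 \<le> (\<Sum>c<d. (x c)\<^sup>2)" using that by (intro member_le_sum) auto
    then have "(x c)\<^sup>2 \<le> 1" using that by linarith
    then show ?thesis by (simp add: abs_square_le_1)
  qed
  then show ?case by (auto simp: layer_input_def)
next
  case (Suc k)
  then obtain Z where
    Z: "\<And>x c. (\<Sum>c<d. (x c)\<^sup>2) \<le> 1 \<Longrightarrow> c < d \<Longrightarrow> \<bar>layer_input (\<lambda>_. d) W \<gamma> \<beta> k x c\<bar> \<le> Z"
    by blast
  define u where "u r = \<bar>\<gamma> (Suc k) r\<bar> * (\<Sum>c<d. \<bar>W (Suc k) r c\<bar> * Z) + \<bar>\<beta> (Suc k) r\<bar>" for r
  have "\<bar>layer_input (\<lambda>_. d) W \<gamma> \<beta> (Suc k) x r\<bar> \<le> Max (u ` {..<d})"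
    if x: "(\<Sum>c<d. (x c)\<^sup>2) \<le> 1" and r: "r < d" for x r
  proof -
    let ?s = "\<Sum>c<d. W (Suc k) r c * layer_input (\<lambda>_. d) W \<gamma> \<beta> k x c"
    have "\<bar>?s\<bar> \<le> (\<Sum>c<d. \<bar>W (Suc k) r c * layer_input (\<lambda>_. d) W \<gamma> \<beta> k x c\<bar>)" by (rule sum_abs)
    also have "\<dots> \<le> (\<Sum>c<d. \<bar>W (Suc k) r c\<bar> * Z)"
      using Z[OF x] by (intro sum_mono) (auto simp: abs_mult intro!: mult_left_mono)
    finally have "\<bar>\<gamma> (Suc k) r * ?s\<bar> \<le> \<bar>\<gamma> (Suc k) r\<bar> * (\<Sum>c<d. \<bar>W (Suc k) r c\<bar> * Z)"
      unfolding abs_mult by (intro mult_left_mono) auto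
    then have "\<bar>netEval (\<lambda>_. d) W \<gamma> \<beta> (Suc k) x r\<bar> \<le> u r"
      unfolding netEval_Suc_layer_input u_def by linarith
    also have "u r \<le> Max (u ` {..<d})" using r by (intro Max_ge) auto
    finally show ?thesis by (auto simp: layer_input_def relu_def)
  qed
  then show ?case by blast
qed

text \<open>Induction on target layers: once the networks agree after \<open>2 * k\<close> and
  \<open>k\<close> layers, the next pair receives the target's own layer input. Its bound
  \<open>Z k\<close> involves the target alone, so the shifts can be fixed before the network is
  assembled.\<close>

lemma reconstruction:
  assumes "\<And>k. k < l \<Longrightarrow> \<exists>g. \<forall>i<d. \<forall>j<d.
      (\<Sum>m<d\<^sup>2. W (2 * k + 2) i m * g m * W (2 * k + 1) m j) = V (Suc k) i j"
  shows "\<exists>\<gamma> \<beta>. \<forall>x. (\<Sum>c<d. (x c)\<^sup>2) \<le> 1 \<longrightarrow> (\<forall>r<d.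
      netEval (recDim d) W \<gamma> \<beta> (2 * l) x r = netEval (\<lambda>_. d) V \<delta> b l x r)"
proof -
  have "\<exists>Z. \<forall>k x. (\<Sum>c<d. (x c)\<^sup>2) \<le> 1 \<longrightarrow> (\<forall>c<d. \<bar>layer_input (\<lambda>_. d) V \<delta> b k x c\<bar> \<le> Z k)"
    by (intro choice allI layer_input_bounded)
  then obtain Z where Z: "\<And>k x. (\<Sum>c<d. (x c)\<^sup>2) \<le> 1 \<Longrightarrow>
      \<forall>c<d. \<bar>layer_input (\<lambda>_. d) V \<delta> b k x c\<bar> \<le> Z k" by blast
  have "\<forall>k\<in>{..<l}. \<exists>g. \<forall>i<d. \<forall>j<d.
      (\<Sum>m<d\<^sup>2. W (2 * k + 2) i m * g m * W (2 * k + 1) m j) = V (Suc k) i j"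
    using assms by blast
  from bchoice[OF this] obtain g where g: "\<And>k i j. k < l \<Longrightarrow> i < d \<Longrightarrow> j < d \<Longrightarrow>
      (\<Sum>m<d\<^sup>2. W (2 * k + 2) i m * g k m * W (2 * k + 1) m j) = V (Suc k) i j"
    by blast
  have "\<forall>k\<in>{..<l}. \<exists>b1 b2. \<forall>z. (\<forall>c<d. \<bar>z c\<bar> \<le> Z k) \<longrightarrow> (\<forall>r<d.
      \<delta> (Suc k) r * (\<Sum>m<d\<^sup>2. W (2 * k + 2) r m *
          relu (\<lambda>m. g k m * (\<Sum>c<d. W (2 * k + 1) m c * z c) + b1 m) m) + b2 r
      = \<delta> (Suc k) r * (\<Sum>c<d. V (Suc k) r c * z c) + b (Suc k) r)"
    using g by (intro ballI linearized_layer_pair) auto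
  from bchoice[OF this] obtain b1 where "\<forall>k\<in>{..<l}. \<exists>b2. \<forall>z. (\<forall>c<d. \<bar>z c\<bar> \<le> Z k) \<longrightarrow> (\<forall>r<d.
      \<delta> (Suc k) r * (\<Sum>m<d\<^sup>2. W (2 * k + 2) r m *
          relu (\<lambda>m. g k m * (\<Sum>c<d. W (2 * k + 1) m c * z c) + b1 k m) m) + b2 r
      = \<delta> (Suc k) r * (\<Sum>c<d. V (Suc k) r c * z c) + b (Suc k) r)" by blast
  from bchoice[OF this] obtain b2 where pair: "\<And>k z r. k < l \<Longrightarrow> \<forall>c<d. \<bar>z c\<bar> \<le> Z k \<Longrightarrow> r < d \<Longrightarrow>
      \<delta> (Suc k) r * (\<Sum>m<d\<^sup>2. W (2 * k + 2) r m *
          relu (\<lambda>m. g k m * (\<Sum>c<d. W (2 * k + 1) m c * z c) + b1 k m) m) + b2 k r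
      = \<delta> (Suc k) r * (\<Sum>c<d. V (Suc k) r c * z c) + b (Suc k) r"
    by blast
  \<comment> \<open>Layers \<open>2 * k + 1\<close> and \<open>2 * k + 2\<close> serve target layer
    \<open>Suc k\<close>. Halving the index gives \<open>k\<close> and \<open>Suc k\<close>
    respectively: the even layer inherits the target scale \<open>\<delta> (Suc k)\<close>, while
    \<open>b2\<close>, indexed from \<open>k\<close>, needs the decrement.\<close>
  define \<gamma> where "\<gamma> i = (if odd i then g (i div 2) else \<delta> (i div 2))" for i
  define \<beta> where "\<beta> i = (if odd i then b1 (i div 2) else b2 (i div 2 - 1))" for i
  have "netEval (recDim d) W \<gamma> \<beta> (2 * k) x r = netEval (\<lambda>_. d) V \<delta> b k x r"
    if x: "(\<Sum>c<d. (x c)\<^sup>2) \<le> 1" and "k \<le> l" "r < d" for x k r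
    using that(2-)
  proof (induction k arbitrary: r)
    case (Suc k)
    let ?z = "layer_input (\<lambda>_. d) V \<delta> b k x"
    have in_eq: "layer_input (recDim d) W \<gamma> \<beta> (2 * k) x c = ?z c" if "c < d" for c
      using Suc.IH[of c] Suc.prems that by (auto simp: layer_input_def relu_def)
    have dims: "recDim d (2 * k) = d" by (simp add: recDim_def)
    have hidden: "netEval (recDim d) W \<gamma> \<beta> (Suc (2 * k)) x
        = (\<lambda>m. g k m * (\<Sum>c<d. W (2 * k + 1) m c * ?z c) + b1 k m)"
      by (rule ext) (simp only: netEval_Suc_layer_input, simp add: dims in_eq \<gamma>_def \<beta>_def)
    have "netEval (recDim d) W \<gamma> \<beta> (2 * Suc k) x r
        = \<delta> (Suc k) r * (\<Sum>m<d\<^sup>2. W (2 * k + 2) r m *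
          layer_input (recDim d) W \<gamma> \<beta> (Suc (2 * k)) x m) + b2 k r"
      using netEval_Suc_layer_input[of "recDim d" W \<gamma> \<beta> "Suc (2 * k)" x r]
      by (simp add: recDim_def \<gamma>_def \<beta>_def)
    also have "layer_input (recDim d) W \<gamma> \<beta> (Suc (2 * k)) x
        = relu (\<lambda>m. g k m * (\<Sum>c<d. W (2 * k + 1) m c * ?z c) + b1 k m)"
      using hidden by (simp add: layer_input_def del: netEval.simps)
    also have "\<delta> (Suc k) r * (\<Sum>m<d\<^sup>2. W (2 * k + 2) r m *
          relu (\<lambda>m. g k m * (\<Sum>c<d. W (2 * k + 1) m c * ?z c) + b1 k m) m) + b2 k r
        = \<delta> (Suc k) r * (\<Sum>c<d. V (Suc k) r c * ?z c) + b (Suc k) r"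
      using Suc.prems Z[OF x] by (intro pair) auto
    finally show ?case by (simp only: netEval_Suc_layer_input)
  qed simp
  then show ?thesis by blast
qed

section \<open>Generic nonvanishing of the determinant\<close>

text \<open>Fubini: the measure of the exceptional set is an iterated integral with coordinate
  \<open>i\<close> innermost, and the inner integral vanishes almost everywhere.\<close>

lemma AE_PiM_insertI:
  fixes M :: "'a measure"
  assumes "prob_space M" and I: "finite I" "i \<notin> I"
    and meas: "{w \<in> space (Pi\<^sub>M (insert i I) (\<lambda>_. M)). \<not> P w} \<in> sets (Pi\<^sub>M (insert i I) (\<lambda>_. M))"
    and AE: "AE w in Pi\<^sub>M I (\<lambda>_. M). AE x in M. P (w(i := x))"
  shows "AE w in Pi\<^sub>M (insert i I) (\<lambda>_. M). P w"
proof -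
  interpret prob_space M by fact
  interpret product_sigma_finite "\<lambda>_. M" by standard
  let ?N = "{w \<in> space (Pi\<^sub>M (insert i I) (\<lambda>_. M)). \<not> P w}"
  have "emeasure (Pi\<^sub>M (insert i I) (\<lambda>_. M)) ?N
      = (\<integral>\<^sup>+ w. indicator ?N w \<partial>Pi\<^sub>M (insert i I) (\<lambda>_. M))"
    using meas by simp
  also have "\<dots> = (\<integral>\<^sup>+ w. (\<integral>\<^sup>+ x. indicator ?N (w(i := x)) \<partial>M) \<partial>Pi\<^sub>M I (\<lambda>_. M))"
    using meas by (intro product_nn_integral_insert[OF I]) auto
  also have "\<dots> = (\<integral>\<^sup>+ w. 0 \<partial>Pi\<^sub>M I (\<lambda>_. M))"
  proof (rule nn_integral_cong_AE, use AE in eventually_elim)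
    case (elim w)
    have "(\<integral>\<^sup>+ x. indicator ?N (w(i := x)) \<partial>M) = (\<integral>\<^sup>+ x. 0 \<partial>M)"
      by (rule nn_integral_cong_AE, use elim in eventually_elim) (auto simp: indicator_def)
    then show ?case by simp
  qed
  finally have "emeasure (Pi\<^sub>M (insert i I) (\<lambda>_. M)) ?N = 0" by simp
  then show ?thesis using meas by (intro AE_I[of _ _ ?N]) auto
qed

text \<open>Splitting off one variable writes the polynomial as \<open>f\<^sub>0 + x f\<^sub>1\<close>, which for
  \<open>f\<^sub>1 \<noteq> 0\<close> has a single zero; an atom of \<open>h\<close> at \<open>0\<close> is harmless because the
  hypothesis on the monomial then concerns \<open>f\<^sub>0\<close> only.\<close>
lemma AE_squarefree_polynomial_nonzero:
  fixes M :: "'a measure" and h :: "'a \<Rightarrow> real" and S :: "'p \<Rightarrow> 'i set"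
  assumes "prob_space M" and h: "h \<in> borel_measurable M"
    and atoms: "\<And>c. c \<noteq> 0 \<Longrightarrow> AE x in M. h x \<noteq> c"
    and "finite I" "finite P" "inj_on S P" "\<And>p. p \<in> P \<Longrightarrow> S p \<subseteq> I" "\<And>p. p \<in> P \<Longrightarrow> c p \<noteq> 0"
  shows "AE w in Pi\<^sub>M I (\<lambda>_. M). (\<exists>p\<in>P. \<forall>e\<in>S p. h (w e) \<noteq> 0) \<longrightarrow>
           (\<Sum>p\<in>P. c p * (\<Prod>e\<in>S p. h (w e))) \<noteq> (0::real)"
  using assms(4-)
proof (induction I arbitrary: P S rule: finite_induct)
  case empty
  have S: "S p = {}" if "p \<in> P" for p using empty that by auto
  have "(\<Sum>p\<in>P. c p * (\<Prod>e\<in>S p. h (w e))) \<noteq> 0" if "p \<in> P" for p w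
  proof -
    \<comment> \<open>All index sets are empty here, so injectivity of \<open>S\<close> leaves a
      single monomial, a nonzero constant.\<close>
    have "x = p" if "x \<in> P" for x
      using inj_onD[OF empty(2), of x p] S that \<open>p \<in> P\<close> by simp
    then have "P = {p}" using \<open>p \<in> P\<close> by blast
    then show ?thesis using S that empty by simp
  qed
  then show ?case by auto
next
  case (insert i I)
  define P0 where "P0 = {p \<in> P. i \<notin> S p}"
  define P1 where "P1 = {p \<in> P. i \<in> S p}"
  define f0 where "f0 w = (\<Sum>p\<in>P0. c p * (\<Prod>e\<in>S p. h (w e)))" for w
  define f1 where "f1 w = (\<Sum>p\<in>P1. c p * (\<Prod>e\<in>S p - {i}. h (w e)))" for w
  have P: "P = P0 \<union> P1" "P0 \<inter> P1 = {}" "finite P0" "finite P1"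
    using insert.prems(1) by (auto simp: P0_def P1_def)
  have finS: "finite (S p)" if "p \<in> P" for p
    using insert.prems(3)[OF that] insert.hyps(1) by (meson finite_insert finite_subset)
  have AE0: "AE w in Pi\<^sub>M I (\<lambda>_. M). (\<exists>p\<in>P0. \<forall>e\<in>S p. h (w e) \<noteq> 0) \<longrightarrow> f0 w \<noteq> 0"
    unfolding f0_def using insert.prems
    by (intro insert.IH) (auto simp: P0_def inj_on_def)
  have AE1: "AE w in Pi\<^sub>M I (\<lambda>_. M). (\<exists>p\<in>P1. \<forall>e\<in>S p - {i}. h (w e) \<noteq> 0) \<longrightarrow> f1 w \<noteq> 0"
    unfolding f1_def
  proof (intro insert.IH)
    \<comment> \<open>Every index set in \<open>P1\<close> contains \<open>i\<close>, so deleting it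
      keeps them distinct.\<close>
    show "inj_on (\<lambda>p. S p - {i}) P1"
      using insert.prems(2) by (auto simp: P1_def inj_on_def)
    show "finite P1" by (rule P(4))
    show "S p - {i} \<subseteq> I" "c p \<noteq> 0" if "p \<in> P1" for p
      using insert.prems(3,4)[of p] that by (auto simp: P1_def)
  qed
  let ?Q = "\<lambda>w. (\<exists>p\<in>P. \<forall>e\<in>S p. h (w e) \<noteq> 0) \<longrightarrow> (\<Sum>p\<in>P. c p * (\<Prod>e\<in>S p. h (w e))) \<noteq> 0"
  have split: "(\<Sum>p\<in>P. c p * (\<Prod>e\<in>S p. h ((w(i := x)) e))) = f0 w + h x * f1 w" for w x
  proof -
    have "(\<Sum>p\<in>P0. c p * (\<Prod>e\<in>S p. h ((w(i := x)) e))) = f0 w"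
      unfolding f0_def by (intro sum.cong refl arg_cong2[where f = "(*)"] prod.cong) (auto simp: P0_def)
    moreover have "(\<Sum>p\<in>P1. c p * (\<Prod>e\<in>S p. h ((w(i := x)) e))) = h x * f1 w"
      unfolding f1_def sum_distrib_left
    proof (rule sum.cong[OF refl])
      fix p assume p: "p \<in> P1"
      have "(\<Prod>e\<in>S p. h ((w(i := x)) e)) = h x * (\<Prod>e\<in>S p - {i}. h ((w(i := x)) e))"
        using p finS by (subst prod.remove[of _ i]) (auto simp: P1_def)
      also have "(\<Prod>e\<in>S p - {i}. h ((w(i := x)) e)) = (\<Prod>e\<in>S p - {i}. h (w e))"
        by (intro prod.cong) auto
      finally show "c p * (\<Prod>e\<in>S p. h ((w(i := x)) e)) = h x * (c p * (\<Prod>e\<in>S p - {i}. h (w e)))"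
        by simp
    qed
    ultimately show ?thesis unfolding P(1) using P by (simp add: sum.union_disjoint)
  qed
  show ?case
  proof (rule AE_PiM_insertI[OF assms(1) insert.hyps])
    note h[measurable]
    have [measurable]: "(\<lambda>w. h (w e)) \<in> borel_measurable (Pi\<^sub>M (insert i I) (\<lambda>_. M))"
      if "p \<in> P" "e \<in> S p" for p e
    proof -
      have "e \<in> insert i I" using insert.prems(3) that by blast
      from measurable_compose[OF measurable_component_singleton[OF this] h] show ?thesis .
    qed
    have a: "{w \<in> space (Pi\<^sub>M (insert i I) (\<lambda>_. M)). (\<Sum>p\<in>P. c p * (\<Prod>e\<in>S p. h (w e))) = 0}
          \<in> sets (Pi\<^sub>M (insert i I) (\<lambda>_. M))" by measurable
    have b: "{w \<in> space (Pi\<^sub>M (insert i I) (\<lambda>_. M)). \<exists>p\<in>P. \<forall>e\<in>S p. h (w e) \<noteq> 0}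
          \<in> sets (Pi\<^sub>M (insert i I) (\<lambda>_. M))"
      using insert.prems(1) finS by (intro sets.sets_Collect_finite_Ex sets.sets_Collect_finite_All) measurable
    show "{w \<in> space (Pi\<^sub>M (insert i I) (\<lambda>_. M)). \<not> ?Q w} \<in> sets (Pi\<^sub>M (insert i I) (\<lambda>_. M))"
      using sets.Int[OF a b] by (rule back_subst) auto
    show "AE w in Pi\<^sub>M I (\<lambda>_. M). AE x in M. ?Q (w(i := x))"
      using AE0 AE1
    proof eventually_elim
      case (elim w)
      \<comment> \<open>A nonvanishing monomial either avoids \<open>i\<close> and is seen by
        \<open>f0\<close>, or contains \<open>i\<close>, which forces \<open>h x \<noteq> 0\<close>
        and leaves a nonvanishing cofactor seen by \<open>f1\<close>.\<close>
      have ex: "(\<exists>p\<in>P0. \<forall>e\<in>S p. h (w e) \<noteq> 0) \<or> h x \<noteq> 0 \<and> (\<exists>p\<in>P1. \<forall>e\<in>S p - {i}. h (w e) \<noteq> 0)"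
        if "\<exists>p\<in>P. \<forall>e\<in>S p. h ((w(i := x)) e) \<noteq> 0" for x
        using that unfolding P(1) by (fastforce simp: P0_def P1_def split: if_splits)
      have vanish: "f1 w = 0" if "\<not> (\<exists>p\<in>P1. \<forall>e\<in>S p - {i}. h (w e) \<noteq> 0)"
        unfolding f1_def using that finS
        by (intro sum.neutral ballI) (auto simp: P1_def)
      \<comment> \<open>The root of the linear polynomial is avoided unless it is \<open>0\<close>.
        Division by zero yields \<open>0\<close>, so the second alternative also covers
        \<open>f1 w = 0\<close>.\<close>
      have "AE x in M. h x \<noteq> - f0 w / f1 w \<or> - f0 w / f1 w = 0"
        using atoms[of "- f0 w / f1 w"] by (cases "- f0 w / f1 w = 0") auto
      then show ?case
      proof eventually_elim
        case (elim x)
        show ?case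
        proof (intro impI)
          assume *: "\<exists>p\<in>P. \<forall>e\<in>S p. h ((w(i := x)) e) \<noteq> 0"
          show "(\<Sum>p\<in>P. c p * (\<Prod>e\<in>S p. h ((w(i := x)) e))) \<noteq> 0"
            unfolding split
          proof
            assume zero: "f0 w + h x * f1 w = 0"
            show False
            proof (cases "f1 w = 0")
              case True
              then show False using zero ex[OF *] \<open>_ \<longrightarrow> f0 w \<noteq> 0\<close> \<open>_ \<longrightarrow> f1 w \<noteq> 0\<close> by auto
            next
              case False
              then have "h x = - f0 w / f1 w" using zero by (simp add: field_simps)
              then have "f0 w = 0" "h x = 0" using elim False by auto
              then show False using ex[OF *] \<open>_ \<longrightarrow> f0 w \<noteq> 0\<close> by auto
            qed
          qed
        qed
      qed
    qed
  qed
qed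

text \<open>Distinct permutations contribute distinct square-free monomials to the determinant of
  the matrix with columns \<open>a\<^sub>m \<otimes> b\<^sub>m\<close>, so nothing cancels.\<close>
lemma AE_column_tensor_det_nonzero:
  fixes M :: "'a measure" and h :: "'a \<Rightarrow> real" and I :: "(nat \<times> nat \<times> nat) set"
  assumes "prob_space M" "h \<in> borel_measurable M" "\<And>c. c \<noteq> 0 \<Longrightarrow> AE x in M. h x \<noteq> c"
    and I: "finite I" and k: "ka \<noteq> kb"
    and mem_a: "\<And>i m. i < d \<Longrightarrow> m < d\<^sup>2 \<Longrightarrow> (ka, i, m) \<in> I"
    and mem_b: "\<And>m j. m < d\<^sup>2 \<Longrightarrow> j < d \<Longrightarrow> (kb, m, j) \<in> I"
  shows "AE w in Pi\<^sub>M I (\<lambda>_. M).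
      (\<exists>p. p permutes {0..<d\<^sup>2} \<and>
        (\<forall>n<d\<^sup>2. h (w (ka, n div d, p n)) \<noteq> 0 \<and> h (w (kb, p n, n mod d)) \<noteq> 0)) \<longrightarrow>
      det (mat (d\<^sup>2) (d\<^sup>2) (\<lambda>(n, m). h (w (ka, n div d, m)) * h (w (kb, m, n mod d)))) \<noteq> 0"
proof -
  let ?N = "{0..<d\<^sup>2}"
  let ?P = "{p. p permutes ?N}"
  \<comment> \<open>Equation \<open>n\<close> stands for the matrix position
    \<open>(n div d, n mod d)\<close>. \<open>Sa p\<close> and \<open>Sb p\<close> collect the
    entries of the two layers in the Leibniz term of \<open>p\<close>; \<open>ka \<noteq> kb\<close>
    keeps them apart.\<close>
  define Sa where "Sa p = (\<lambda>n. (ka, n div d, p n)) ` ?N" for p :: "nat \<Rightarrow> nat"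
  define Sb where "Sb p = (\<lambda>n. (kb, p n, n mod d)) ` ?N" for p :: "nat \<Rightarrow> nat"
  define S where "S p = Sa p \<union> Sb p" for p
  have lt: "n div d < d" "n mod d < d" if "n < d\<^sup>2" for n
  proof -
    show "n div d < d" using that by (simp add: less_mult_imp_div_less power2_eq_square)
    show "n mod d < d" using that by (cases "d = 0") auto
  qed
  have perm: "p n < d\<^sup>2" if "p \<in> ?P" "n < d\<^sup>2" for p n
    using permutes_in_image[of p ?N n] that by simp
  have inj: "inj_on S ?P"
  proof (rule inj_onI)
    fix p p' assume p: "p \<in> ?P" and p': "p' \<in> ?P" and eq: "S p = S p'"
    have "p n = p' n" if n: "n < d\<^sup>2" for n
    proof -
      have "(ka, n div d, p n) \<in> S p'" unfolding eq[symmetric] using n by (auto simp: S_def Sa_def)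
      then obtain n1 where n1: "n1 < d\<^sup>2" "n div d = n1 div d" "p n = p' n1"
        using k by (auto simp: S_def Sa_def Sb_def)
      have "(kb, p n, n mod d) \<in> S p'" unfolding eq[symmetric] using n by (auto simp: S_def Sb_def)
      then obtain n2 where n2: "n2 < d\<^sup>2" "n mod d = n2 mod d" "p n = p' n2"
        using k by (auto simp: S_def Sa_def Sb_def)
      \<comment> \<open>One layer reveals \<open>n div d\<close>, the other \<open>n mod d\<close>;
        the common column \<open>p n\<close> and injectivity of \<open>p'\<close> tie both to the
        same equation.\<close>
      have "n1 = n2" using n1(3) n2(3) p' by (auto dest!: permutes_inj dest: injD)
      then have "n = n1" using n1(2) n2(2) by (metis div_mult_mod_eq)
      then show ?thesis using n1(3) by simp
    qed
    moreover have "p n = p' n" if "\<not> n < d\<^sup>2" for n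
      using p p' that by (auto simp: permutes_def)
    ultimately show "p = p'" by blast
  qed
  have prod_S: "(\<Prod>e\<in>S p. h (w e)) = (\<Prod>n\<in>?N. h (w (ka, n div d, p n)) * h (w (kb, p n, n mod d)))"
    if p: "p \<in> ?P" for p w
  proof -
    have injp: "inj p" using p by (auto dest: permutes_inj)
    have "(\<Prod>e\<in>S p. h (w e)) = (\<Prod>e\<in>Sa p. h (w e)) * (\<Prod>e\<in>Sb p. h (w e))"
      unfolding S_def using k by (intro prod.union_disjoint) (auto simp: Sa_def Sb_def)
    also have "(\<Prod>e\<in>Sa p. h (w e)) = (\<Prod>n\<in>?N. h (w (ka, n div d, p n)))"
      unfolding Sa_def by (subst prod.reindex) (auto simp: inj_on_def dest: injD[OF injp])
    also have "(\<Prod>e\<in>Sb p. h (w e)) = (\<Prod>n\<in>?N. h (w (kb, p n, n mod d)))"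
      unfolding Sb_def by (subst prod.reindex) (auto simp: inj_on_def dest: injD[OF injp])
    finally show ?thesis by (simp add: prod.distrib)
  qed
  have "AE w in Pi\<^sub>M I (\<lambda>_. M). (\<exists>p\<in>?P. \<forall>e\<in>S p. h (w e) \<noteq> 0) \<longrightarrow>
      (\<Sum>p\<in>?P. signof p * (\<Prod>e\<in>S p. h (w e))) \<noteq> 0"
  proof (rule AE_squarefree_polynomial_nonzero[OF assms(1-3) I _ inj])
    show "finite ?P" by (simp add: finite_permutations)
    show "S p \<subseteq> I" if "p \<in> ?P" for p
      using lt perm[OF that] mem_a mem_b by (auto simp: S_def Sa_def Sb_def)
    show "signof p \<noteq> (0::real)" for p :: "nat \<Rightarrow> nat" by (simp add: sign_def)
  qed
  then show ?thesis
  proof eventually_elim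
    case (elim w)
    have "det (mat (d\<^sup>2) (d\<^sup>2) (\<lambda>(n, m). h (w (ka, n div d, m)) * h (w (kb, m, n mod d))))
        = (\<Sum>p\<in>?P. signof p * (\<Prod>e\<in>S p. h (w e)))"
      by (subst det_def'[of _ "d\<^sup>2"]) (auto simp: prod_S perm intro!: sum.cong prod.cong)
    moreover have "\<exists>p\<in>?P. \<forall>e\<in>S p. h (w e) \<noteq> 0"
      if "\<exists>p. p permutes ?N \<and> (\<forall>n<d\<^sup>2. h (w (ka, n div d, p n)) \<noteq> 0 \<and> h (w (kb, p n, n mod d)) \<noteq> 0)"
      using that by (fastforce simp: S_def Sa_def Sb_def)
    ultimately show ?case using elim by simp
  qed
qed

section \<open>Matchings in the random zero pattern\<close>

text \<open>Conditioning on the zero pattern \<open>Z w\<close> of the entries in \<open>A\<close>, the family of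
  entries that has to avoid vanishing may depend on that pattern.\<close>
lemma measure_zero_pattern_union_le:
  fixes M :: "'a measure" and h :: "'a \<Rightarrow> real" and F :: "'i set \<Rightarrow> 't \<Rightarrow> 'i set"
  defines "Z w A \<equiv> {e \<in> A. h (w e) \<noteq> 0}"
  defines "q \<equiv> measure M {x \<in> space M. h x = 0}"
  assumes "prob_space M" and [measurable]: "h \<in> borel_measurable M"
    and I: "finite I" "A \<subseteq> I" and T: "finite T"
    and F: "\<And>K t. K \<subseteq> A \<Longrightarrow> t \<in> T \<Longrightarrow> F K t \<subseteq> I - A"
    and weight: "\<And>K. K \<subseteq> A \<Longrightarrow> (\<Sum>t\<in>T. q ^ card (F K t)) \<le> \<epsilon>"
  shows "{w \<in> space (Pi\<^sub>M I (\<lambda>_. M)). \<exists>t\<in>T. \<forall>e\<in>F (Z w A) t. h (w e) = 0} \<in> sets (Pi\<^sub>M I (\<lambda>_. M))"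
      (is "?bad \<in> sets ?\<Omega>")
    and "measure (Pi\<^sub>M I (\<lambda>_. M)) {w \<in> space (Pi\<^sub>M I (\<lambda>_. M)). \<exists>t\<in>T. \<forall>e\<in>F (Z w A) t. h (w e) = 0} \<le> \<epsilon>"
proof -
  interpret M: prob_space M by fact
  interpret product_prob_space "\<lambda>_. M" I by standard
  \<comment> \<open>On \<open>A\<close> these conditions prescribe the nonzero pattern
    \<open>K\<close> exactly; on \<open>F K t\<close>, disjoint from \<open>A\<close>, they demand
    zeros. Each \<open>cyl K t\<close> is therefore a product event.\<close>
  define X where "X K e = (if e \<in> K then {x \<in> space M. h x \<noteq> 0} else {x \<in> space M. h x = 0})" for K and e :: 'i
  define cyl where "cyl K t = {w \<in> space ?\<Omega>. \<forall>e\<in>A \<union> F K t. w e \<in> X K e}" for K t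
  have finA: "finite A" using I finite_subset by blast
  have finF: "finite (F K t)" if "K \<subseteq> A" "t \<in> T" for K t
    using F[OF that] I(1) by (meson finite_Diff finite_subset)
  have X [measurable]: "X K e \<in> sets M" for K e by (simp add: X_def)
  have "M.prob {x \<in> space M. h x \<noteq> 0} = 1 - q"
    unfolding q_def by (subst M.prob_neg[symmetric]) auto
  then have mX: "measure M (X K e) = (if e \<in> K then 1 - q else q)" for K e
    by (simp add: X_def q_def)
  have cyl_sets: "cyl K t \<in> sets ?\<Omega>" if "K \<subseteq> A" "t \<in> T" for K t
  proof -
    have "{w \<in> space ?\<Omega>. w e \<in> X K e} \<in> sets ?\<Omega>" if "e \<in> A \<union> F K t" for e
    proof -
      have "e \<in> I" using that F[OF \<open>K \<subseteq> A\<close> \<open>t \<in> T\<close>] I(2) by blast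
      then have "(\<lambda>w. w e) -` X K e \<inter> space ?\<Omega> \<in> sets ?\<Omega>"
        by (intro measurable_sets[OF _ X] measurable_component_singleton)
      then show ?thesis by (simp add: vimage_def Int_def conj_commute)
    qed
    then show ?thesis
      unfolding cyl_def using finA finF[OF that] by (intro sets.sets_Collect_finite_All) auto
  qed
  have cyl_measure: "measure ?\<Omega> (cyl K t) = (\<Prod>e\<in>K. 1 - q) * (\<Prod>e\<in>A - K. q) * q ^ card (F K t)"
    if K: "K \<subseteq> A" and t: "t \<in> T" for K t
  proof -
    have "emeasure ?\<Omega> (cyl K t) = (\<Prod>e\<in>A \<union> F K t. emeasure M (X K e))"
      unfolding cyl_def using F[OF K t] I finA finF[OF K t] by (intro emeasure_PiM_Collect) auto
    also have "\<dots> = ennreal (\<Prod>e\<in>A \<union> F K t. measure M (X K e))"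
      by (simp add: M.emeasure_eq_measure prod_ennreal)
    finally have "measure ?\<Omega> (cyl K t) = (\<Prod>e\<in>A \<union> F K t. measure M (X K e))"
      by (simp add: measure_def prod_nonneg)
    also have "\<dots> = (\<Prod>e\<in>A. measure M (X K e)) * (\<Prod>e\<in>F K t. measure M (X K e))"
      using F[OF K t] finA finF[OF K t] by (intro prod.union_disjoint) auto
    also have "(\<Prod>e\<in>A. measure M (X K e)) = (\<Prod>e\<in>A - K. measure M (X K e)) * (\<Prod>e\<in>K. measure M (X K e))"
      using K finA by (rule prod.subset_diff)
    also have "(\<Prod>e\<in>A - K. measure M (X K e)) = (\<Prod>e\<in>A - K. q)"
      by (intro prod.cong) (auto simp: mX)
    also have "(\<Prod>e\<in>K. measure M (X K e)) = (\<Prod>e\<in>K. 1 - q)"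
      by (intro prod.cong) (auto simp: mX)
    also have "(\<Prod>e\<in>F K t. measure M (X K e)) = (\<Prod>e\<in>F K t. q)"
      using F[OF K t] K by (intro prod.cong) (auto simp: mX)
    finally show ?thesis by (simp add: mult_ac)
  qed
  have bad: "?bad = (\<Union>K\<in>Pow A. \<Union>t\<in>T. cyl K t)"
  proof (intro subset_antisym subsetI)
    fix w assume "w \<in> ?bad"
    then obtain t where w: "w \<in> space ?\<Omega>" "t \<in> T" "\<forall>e\<in>F (Z w A) t. h (w e) = 0" by blast
    have ZA: "Z w A \<subseteq> A" by (auto simp: Z_def)
    have "w e \<in> space M" if "e \<in> A \<union> F (Z w A) t" for e
      using w(1) that F[OF ZA w(2)] I(2) by (auto simp: space_PiM)
    then have "w \<in> cyl (Z w A) t"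
      using w F[OF ZA w(2)] unfolding cyl_def X_def Z_def by auto
    then show "w \<in> (\<Union>K\<in>Pow A. \<Union>t\<in>T. cyl K t)" using ZA w(2) by blast
  next
    fix w assume "w \<in> (\<Union>K\<in>Pow A. \<Union>t\<in>T. cyl K t)"
    then obtain K t where w: "K \<subseteq> A" "t \<in> T" "w \<in> cyl K t" by blast
    have "Z w A = K"
      using w(1,3) by (auto simp: Z_def cyl_def X_def split: if_splits)
    then show "w \<in> ?bad"
      using w F[OF w(1,2)] by (fastforce simp: cyl_def X_def split: if_splits)
  qed
  show "?bad \<in> sets ?\<Omega>"
    unfolding bad using finA T cyl_sets by (intro sets.finite_UN) auto
  have "measure ?\<Omega> ?bad \<le> (\<Sum>K\<in>Pow A. measure ?\<Omega> (\<Union>t\<in>T. cyl K t))"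
    unfolding bad using finA T cyl_sets
    by (intro finite_measure_subadditive_finite image_subsetI sets.finite_UN) auto
  also have "\<dots> \<le> (\<Sum>K\<in>Pow A. \<Sum>t\<in>T. measure ?\<Omega> (cyl K t))"
    using T cyl_sets by (intro sum_mono finite_measure_subadditive_finite) auto
  also have "\<dots> = (\<Sum>K\<in>Pow A. (\<Prod>e\<in>K. 1 - q) * (\<Prod>e\<in>A - K. q) * (\<Sum>t\<in>T. q ^ card (F K t)))"
    by (intro sum.cong refl) (simp add: cyl_measure sum_distrib_left)
  also have "\<dots> \<le> (\<Sum>K\<in>Pow A. (\<Prod>e\<in>K. 1 - q) * (\<Prod>e\<in>A - K. q) * \<epsilon>)"
    using weight by (intro sum_mono mult_left_mono mult_nonneg_nonneg prod_nonneg) (auto simp: q_def)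
  \<comment> \<open>Expanding the product over subsets of \<open>A\<close> shows that the pattern
    probabilities sum to 1.\<close>
  also have "\<dots> = (\<Prod>e\<in>A. (1 - q) + q) * \<epsilon>"
    unfolding sum_distrib_right[symmetric] by (subst prod_add[OF finA]) simp
  finally show "measure ?\<Omega> ?bad \<le> \<epsilon>" by simp
qed

section \<open>Gluing block matchings into one permutation\<close>

lemma block_index_less:
  assumes "b < d" "s < d"
  shows "b * d + s < (d::nat)\<^sup>2"
proof -
  have "b * d + s < Suc b * d" using assms by simp
  also have "\<dots> \<le> d * d" using assms by (intro mult_right_mono) auto
  finally show ?thesis by (simp add: power2_eq_square)
qed

text \<open>Division by \<open>d\<close> recovers the block, and injectivity within the block
  recovers \<open>i\<close>; surjectivity follows by counting.\<close>

lemma bij_betw_blocks: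
  fixes \<sigma> :: "nat \<Rightarrow> nat \<Rightarrow> nat"
  assumes "\<And>b. b < d \<Longrightarrow> bij_betw (\<sigma> b) {..<d} {..<d}"
  shows "bij_betw (\<lambda>(b, i). b * d + \<sigma> b i) ({..<d} \<times> {..<d}) {..<d\<^sup>2}"
proof -
  let ?f = "\<lambda>(b, i). b * d + \<sigma> b i"
  have lt: "\<sigma> b i < d" if "b < d" "i < d" for b i
    using assms[OF that(1)] that(2) by (auto simp: bij_betw_def)
  have inj: "inj_on ?f ({..<d} \<times> {..<d})"
  proof (rule inj_onI, clarify)
    fix b i b' i' assume *: "b < d" "i < d" "b' < d" "i' < d" "b * d + \<sigma> b i = b' * d + \<sigma> b' i'"
    have "(b * d + \<sigma> b i) div d = b" "(b' * d + \<sigma> b' i') div d = b'"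
      using lt[OF *(1,2)] lt[OF *(3,4)] by simp_all
    then have b: "b = b'" using *(5) by simp
    then have "\<sigma> b i = \<sigma> b i'" using * by simp
    then show "b = b' \<and> i = i'"
      using assms[of b] * b by (auto simp: bij_betw_def dest: inj_onD)
  qed
  have sub: "?f ` ({..<d} \<times> {..<d}) \<subseteq> {..<d\<^sup>2}"
    using block_index_less lt by auto
  have "?f ` ({..<d} \<times> {..<d}) = {..<d\<^sup>2}"
    by (rule card_subset_eq[OF _ sub]) (simp_all add: card_image[OF inj] power2_eq_square)
  then show ?thesis using inj by (simp add: bij_betw_def)
qed

text \<open>The permutation sends equation \<open>i * d + \<rho> i b\<close> to column
  \<open>b * d + \<sigma> b i\<close>. Both expressions run bijectively through the indices as
  \<open>(i, b)\<close> varies: \<open>\<sigma>\<close> assigns one column of each block to row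
  \<open>i\<close>, and \<open>\<rho>\<close> spreads these columns over the positions in that
  row.\<close>

lemma perfect_matching_from_blocks:
  fixes \<sigma> \<rho> :: "nat \<Rightarrow> nat \<Rightarrow> nat"
  assumes \<sigma>: "\<And>b. b < d \<Longrightarrow> bij_betw (\<sigma> b) {..<d} {..<d}"
    and \<rho>: "\<And>i. i < d \<Longrightarrow> bij_betw (\<rho> i) {..<d} {..<d}"
    and a: "\<And>b i. b < d \<Longrightarrow> i < d \<Longrightarrow> a i (b * d + \<sigma> b i)"
    and c: "\<And>b i. b < d \<Longrightarrow> i < d \<Longrightarrow> c (b * d + \<sigma> b i) (\<rho> i b)"
  shows "\<exists>p. p permutes {0..<d\<^sup>2} \<and> (\<forall>n<d\<^sup>2. a (n div d) (p n) \<and> c (p n) (n mod d))"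
proof -
  let ?S = "{..<d} \<times> {..<d}"
  let ?f = "\<lambda>(b, i). b * d + \<sigma> b i" and ?g = "\<lambda>(i, b). i * d + \<rho> i b"
  have f: "bij_betw ?f ?S {..<d\<^sup>2}" by (rule bij_betw_blocks[OF \<sigma>])
  have g: "bij_betw ?g ?S {..<d\<^sup>2}" by (rule bij_betw_blocks[OF \<rho>])
  have swap: "bij_betw prod.swap ?S ?S" by (auto simp: bij_betw_def inj_on_def)
  \<comment> \<open>The value \<open>n\<close> outside the range is what \<open>permutes\<close>
    requires.\<close>
  define p where "p n = (if n < d\<^sup>2 then ?f (prod.swap (inv_into ?S ?g n)) else n)" for n
  have "bij_betw (?f \<circ> prod.swap \<circ> inv_into ?S ?g) {..<d\<^sup>2} {..<d\<^sup>2}"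
    using bij_betw_trans[OF bij_betw_inv_into[OF g] bij_betw_trans[OF swap f]] by (simp add: comp_assoc)
  then have "bij_betw p {0..<d\<^sup>2} {0..<d\<^sup>2}"
    by (subst bij_betw_cong[of _ _ "?f \<circ> prod.swap \<circ> inv_into ?S ?g"])
      (auto simp: p_def atLeast0LessThan)
  then have "p permutes {0..<d\<^sup>2}"
    by (rule bij_imp_permutes) (simp add: p_def)
  moreover have "a (n div d) (p n) \<and> c (p n) (n mod d)" if n: "n < d\<^sup>2" for n
  proof -
    obtain i b where ib: "inv_into ?S ?g n = (i, b)" by (cases "inv_into ?S ?g n")
    have mem: "n \<in> ?g ` ?S" using g n by (simp add: bij_betw_def)
    have "(i, b) \<in> ?S" using inv_into_into[OF mem] ib by simp
    then have lt: "i < d" "b < d" by auto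
    have "n = i * d + \<rho> i b" using f_inv_into_f[OF mem] ib by simp
    moreover have "\<rho> i b < d" using \<rho>[OF lt(1)] lt(2) by (auto simp: bij_betw_def)
    ultimately have "n div d = i" "n mod d = \<rho> i b" by auto
    moreover have "p n = b * d + \<sigma> b i" using n ib by (simp add: p_def)
    ultimately show ?thesis using a c lt by simp
  qed
  ultimately show ?thesis by blast
qed

lemma finite_Idx [simp]: "finite (Idx d l)"
  by (rule finite_subset[of _ "{..2 * l} \<times> {..d + d\<^sup>2} \<times> {..d + d\<^sup>2}"])
    (auto simp: Idx_def recDim_def split: if_splits)

lemma Idx_even_iff: "(2 * k + 2, i, m) \<in> Idx d l \<longleftrightarrow> k < l \<and> i < d \<and> m < d\<^sup>2"
  by (auto simp: Idx_def recDim_def)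

lemma Idx_odd_iff: "(2 * k + 1, m, j) \<in> Idx d l \<longleftrightarrow> k < l \<and> m < d\<^sup>2 \<and> j < d"
  by (auto simp: Idx_def recDim_def)

text \<open>Union bound over layer pairs and over \<open>d\<close> bipartite graphs in each. The
  family \<open>F\<close> is left abstract so that both rounds of matchings can use it.\<close>

lemma blockers_weight_sum_le:
  fixes q t :: real and l :: nat
  assumes "0 \<le> q" "q \<le> exp (- t)" "0 \<le> t" "(real d)\<^sup>2 * exp (- t * d / 2) \<le> 1"
    and card: "\<And>k b X Y. k < l \<Longrightarrow> b < d \<Longrightarrow> (X, Y) \<in> blockers d \<Longrightarrow> card (F (k, b, X, Y)) = card X * card Y"
  shows "(\<Sum>x\<in>{..<l} \<times> {..<d} \<times> blockers d. q ^ card (F x)) \<le> l * real d ^ 4 * exp (- t * d / 2)"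
proof -
  have "(\<Sum>x\<in>{..<l} \<times> {..<d} \<times> blockers d. q ^ card (F x))
      = (\<Sum>k<l. \<Sum>b<d. \<Sum>(X, Y)\<in>blockers d. q ^ (card X * card Y))"
    by (simp only: sum.cartesian_product) (auto intro!: sum.cong simp: card)
  also have "\<dots> = l * (d * (\<Sum>(X, Y)\<in>blockers d. q ^ (card X * card Y)))" by simp
  also have "\<dots> \<le> l * (d * (real d ^ 3 * exp (- t * d / 2)))"
    using blockers_weight_le[OF assms(1-4)] by (intro mult_left_mono) auto
  also have "\<dots> = l * real d ^ 4 * exp (- t * d / 2)"
    by (simp add: power3_eq_cube power4_eq_xxxx)
  finally show ?thesis .
qed

text \<open>The row of a column \<open>m = b d + s\<close> is found by matching, inside each block \<open>b\<close>, the
  offsets \<open>s\<close> to the rows along nonzero entries of the even layer. Given that choice,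
  the \<open>d\<close> columns belonging to a row \<open>i\<close> are matched to \<open>{..<d}\<close> along nonzero
  entries of the odd layer.\<close>
lemma good_event:
  fixes M :: "'a measure" and h :: "'a \<Rightarrow> real"
  assumes M: "prob_space M" and h: "h \<in> borel_measurable M"
    and atoms: "\<And>c. c \<noteq> 0 \<Longrightarrow> AE x in M. h x \<noteq> c"
    and q: "measure M {x \<in> space M. h x = 0} \<le> exp (- t)" and t: "0 \<le> t"
    and small: "(real d)\<^sup>2 * exp (- t * d / 2) \<le> 1"
  shows "\<exists>E\<in>sets (Pi\<^sub>M (Idx d l) (\<lambda>_. M)).
      measure (Pi\<^sub>M (Idx d l) (\<lambda>_. M)) E \<ge> 1 - 2 * real l * real d ^ 4 * exp (- t * d / 2) \<and>
      (\<forall>w\<in>E. \<forall>k<l. det (mat (d\<^sup>2) (d\<^sup>2) (\<lambda>(n, m).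
         h (w (2 * k + 2, n div d, m)) * h (w (2 * k + 1, m, n mod d)))) \<noteq> 0)"
proof -
  let ?I = "Idx d l"
  let ?\<Omega> = "Pi\<^sub>M ?I (\<lambda>_. M)"
  let ?q = "measure M {x \<in> space M. h x = 0}"
  let ?T = "{..<l} \<times> {..<d} \<times> blockers d"
  let ?\<epsilon> = "l * real d ^ 4 * exp (- t * d / 2)"
  let ?det = "\<lambda>w k. det (mat (d\<^sup>2) (d\<^sup>2) (\<lambda>(n, m).
         h (w (2 * k + 2, n div d, m)) * h (w (2 * k + 1, m, n mod d))))"
  interpret M: prob_space M by (rule M)
  interpret product_prob_space "\<lambda>_. M" ?I by standard
  define A where "A = {e \<in> ?I. even (fst e)}"
  define Z where "Z w = {e \<in> A. h (w e) \<noteq> 0}" for w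
  define R where "R K k b \<sigma> \<longleftrightarrow> bij_betw \<sigma> {..<d} {..<d} \<and> (\<forall>i<d. (2 * k + 2, i, b * d + \<sigma> i) \<in> K)"
    for K :: "(nat \<times> nat \<times> nat) set" and k b \<sigma>
  \<comment> \<open>The choice depends on the pattern \<open>K\<close> alone, so it is fixed once
    the even layers are. The default \<open>id\<close> makes it a bijection for every
    \<open>K\<close>, as the weight bound must hold also for patterns without a matching.\<close>
  define s where "s K k b = (if Ex (R K k b) then SOME \<sigma>. R K k b \<sigma> else id)" for K k b
  have s_bij: "bij_betw (s K k b) {..<d} {..<d}" for K k b
  proof (cases "Ex (R K k b)")
    case True
    then have "R K k b (s K k b)" using someI_ex[OF True] by (simp add: s_def)
    then show ?thesis by (simp add: R_def)
  qed (auto simp: s_def)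
  have s_lt: "s K k b i < d" if "i < d" for K k b i
    using s_bij[of K k b] that by (auto simp: bij_betw_def)
  define F1 where "F1 K = (\<lambda>(k :: nat, b, X, Y). (\<lambda>(i :: nat, j). (2 * k + 2, i, b * d + j)) ` (X \<times> Y))"
    for K :: "(nat \<times> nat \<times> nat) set"
  \<comment> \<open>The graph for row \<open>i\<close> has the blocks \<open>b\<close> on one side,
    each represented by the odd-layer row \<open>b * d + s K k b i\<close>, and the columns
    \<open>j\<close> on the other.\<close>
  define F2 where "F2 K = (\<lambda>(k, i, X, Y). (\<lambda>(b, j :: nat). (2 * k + 1, b * d + s K k b i, j)) ` (X \<times> Y))"
    for K
  \<comment> \<open>The first round conditions on nothing; the empty pattern gives it the form of
    the general estimate with \<open>A = {}\<close>.\<close>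
  define bad1 where "bad1 = {w \<in> space ?\<Omega>. \<exists>x\<in>?T. \<forall>e\<in>F1 {e \<in> {}. h (w e) \<noteq> 0} x. h (w e) = 0}"
  define bad2 where "bad2 = {w \<in> space ?\<Omega>. \<exists>x\<in>?T. \<forall>e\<in>F2 {e \<in> A. h (w e) \<noteq> 0} x. h (w e) = 0}"
  have in_range: "x < d" "y < d" if "(X, Y) \<in> blockers d" "x \<in> X" "y \<in> Y" for X Y x y
    using that by (auto simp: blockers_def)
  have fin_T: "finite ?T" by simp
  have F1_sub: "F1 K x \<subseteq> ?I - {}" if "x \<in> ?T" for K x
    using that in_range block_index_less by (auto simp: F1_def Idx_even_iff[simplified])
  have F2_sub: "F2 K x \<subseteq> ?I - A" if "x \<in> ?T" for K x
    using that in_range block_index_less s_lt by (auto simp: F2_def A_def Idx_odd_iff[simplified])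
  have w1: "(\<Sum>x\<in>?T. ?q ^ card (F1 K x)) \<le> ?\<epsilon>" for K
  proof (rule blockers_weight_sum_le[OF _ q t small])
    show "card (F1 K (k, b, X, Y)) = card X * card Y" for k b X Y
      unfolding F1_def by (simp add: card_image inj_on_def card_cartesian_product)
  qed simp
  have w2: "(\<Sum>x\<in>?T. ?q ^ card (F2 K x)) \<le> ?\<epsilon>" for K
  proof (rule blockers_weight_sum_le[OF _ q t small])
    fix k i X Y assume *: "k < l" "i < d" "(X, Y) \<in> blockers d"
    have "b = b'" if eq: "b * d + s K k b i = b' * d + s K k b' i" for b b'
    proof -
      have "(c * d + s K k c i) div d = c" for c using s_lt[OF *(2), of K k c] by simp
      then show ?thesis using eq by metis
    qed
    \<comment> \<open>Different blocks select different rows, so the entries are distinct and the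
      exponent is the full \<open>card X * card Y\<close>.\<close>
    then have "inj_on (\<lambda>(b, j). (2 * k + 1, b * d + s K k b i, j)) (X \<times> Y)"
      by (intro inj_onI, unfold split_paired_all prod.case prod.inject) blast
    then show "card (F2 K (k, i, X, Y)) = card X * card Y"
      unfolding F2_def by (simp add: card_image card_cartesian_product)
  qed simp
  have bad1: "bad1 \<in> sets ?\<Omega>" "measure ?\<Omega> bad1 \<le> ?\<epsilon>"
    unfolding bad1_def
    by (rule measure_zero_pattern_union_le[OF M h finite_Idx empty_subsetI fin_T],
        rule F1_sub, assumption, rule w1)+
  have A_sub: "A \<subseteq> ?I" by (auto simp: A_def)
  have bad2: "bad2 \<in> sets ?\<Omega>" "measure ?\<Omega> bad2 \<le> ?\<epsilon>"
    unfolding bad2_def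
    by (rule measure_zero_pattern_union_le[OF M h finite_Idx A_sub fin_T],
        rule F2_sub, assumption, rule w2)+
  have matching: "\<exists>p. p permutes {0..<d\<^sup>2} \<and>
        (\<forall>n<d\<^sup>2. h (w (2 * k + 2, n div d, p n)) \<noteq> 0 \<and> h (w (2 * k + 1, p n, n mod d)) \<noteq> 0)"
    if w: "w \<in> space ?\<Omega>" "w \<notin> bad1" "w \<notin> bad2" and k: "k < l" for w k
  proof -
    have ex: "Ex (R (Z w) k b)" if b: "b < d" for b
    proof -
      have "\<exists>\<sigma>. bij_betw \<sigma> {..<d} {..<d} \<and> (\<forall>i<d. h (w (2 * k + 2, i, b * d + \<sigma> i)) \<noteq> 0)"
      proof (rule matching_or_blocker)
        fix X Y assume "(X, Y) \<in> blockers d"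
        then have "(k, b, X, Y) \<in> ?T" using k b by simp
        then show "\<exists>x\<in>X. \<exists>y\<in>Y. h (w (2 * k + 2, x, b * d + y)) \<noteq> 0"
          using w unfolding bad1_def F1_def by fastforce
      qed
      then obtain \<sigma> where \<sigma>: "bij_betw \<sigma> {..<d} {..<d}" "\<forall>i<d. h (w (2 * k + 2, i, b * d + \<sigma> i)) \<noteq> 0"
        by blast
      have "(2 * k + 2, i, b * d + \<sigma> i) \<in> A" if "i < d" for i
      proof -
        have "\<sigma> i < d" using \<sigma>(1) that by (auto simp: bij_betw_def)
        then have "(2 * k + 2, i, b * d + \<sigma> i) \<in> ?I"
          unfolding Idx_even_iff using that k b block_index_less by blast
        then show ?thesis by (simp add: A_def)
      qed
      then show ?thesis using \<sigma> unfolding R_def Z_def by blast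
    qed
    \<comment> \<open>Outside \<open>bad1\<close> the default is never taken, so \<open>s\<close>
      consists of matchings along nonzero entries.\<close>
    have R_s: "R (Z w) k b (s (Z w) k b)" if "b < d" for b
      using someI_ex[OF ex[OF that]] ex[OF that] by (simp add: s_def)
    have "\<forall>i\<in>{..<d}. \<exists>\<rho>. bij_betw \<rho> {..<d} {..<d} \<and>
        (\<forall>b<d. h (w (2 * k + 1, b * d + s (Z w) k b i, \<rho> b)) \<noteq> 0)"
    proof (intro ballI matching_or_blocker)
      fix i X Y assume "i \<in> {..<d}" "(X, Y) \<in> blockers d"
      then have "(k, i, X, Y) \<in> ?T" using k by simp
      then show "\<exists>x\<in>X. \<exists>y\<in>Y. h (w (2 * k + 1, x * d + s (Z w) k x i, y)) \<noteq> 0"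
        using w unfolding bad2_def F2_def Z_def by fastforce
    qed
    from bchoice[OF this] obtain \<rho> where \<rho>: "\<forall>i\<in>{..<d}. bij_betw (\<rho> i) {..<d} {..<d} \<and>
        (\<forall>b<d. h (w (2 * k + 1, b * d + s (Z w) k b i, \<rho> i b)) \<noteq> 0)" by blast
    show ?thesis
    proof (rule perfect_matching_from_blocks[where \<sigma> = "s (Z w) k" and \<rho> = \<rho>])
      show "h (w (2 * k + 2, i, b * d + s (Z w) k b i)) \<noteq> 0" if "b < d" "i < d" for b i
        using R_s[OF that(1)] that(2) by (auto simp: R_def Z_def)
    qed (use s_bij \<rho> in auto)
  qed
  have "AE w in ?\<Omega>. \<forall>k\<in>{..<l}. (\<exists>p. p permutes {0..<d\<^sup>2} \<and>
        (\<forall>n<d\<^sup>2. h (w (2 * k + 2, n div d, p n)) \<noteq> 0 \<and> h (w (2 * k + 1, p n, n mod d)) \<noteq> 0))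
        \<longrightarrow> ?det w k \<noteq> 0"
  proof (rule AE_finite_allI)
    show "AE w in ?\<Omega>. (\<exists>p. p permutes {0..<d\<^sup>2} \<and>
        (\<forall>n<d\<^sup>2. h (w (2 * k + 2, n div d, p n)) \<noteq> 0 \<and> h (w (2 * k + 1, p n, n mod d)) \<noteq> 0))
        \<longrightarrow> ?det w k \<noteq> 0" if k: "k \<in> {..<l}" for k
    proof (rule AE_column_tensor_det_nonzero[OF M h atoms finite_Idx])
      show "(2 * k + 2, i, m) \<in> ?I" if "i < d" "m < d\<^sup>2" for i m
        unfolding Idx_even_iff using that k by simp
      show "(2 * k + 1, m, j) \<in> ?I" if "m < d\<^sup>2" "j < d" for m j
        unfolding Idx_odd_iff using that k by simp
      show "2 * k + 2 \<noteq> 2 * k + 1" by simp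
    qed
  qed simp
  then obtain N where N: "N \<in> sets ?\<Omega>" "emeasure ?\<Omega> N = 0" and
    N_sub: "\<And>w k. w \<in> space ?\<Omega> - N \<Longrightarrow> k < l \<Longrightarrow> (\<exists>p. p permutes {0..<d\<^sup>2} \<and>
        (\<forall>n<d\<^sup>2. h (w (2 * k + 2, n div d, p n)) \<noteq> 0 \<and> h (w (2 * k + 1, p n, n mod d)) \<noteq> 0))
        \<Longrightarrow> ?det w k \<noteq> 0"
    by (elim AE_E) blast
  \<comment> \<open>\<open>N\<close> is the null set on which a determinant may vanish despite a
    matching.\<close>
  define E where "E = space ?\<Omega> - (bad1 \<union> bad2 \<union> N)"
  have "measure ?\<Omega> (bad1 \<union> bad2 \<union> N) \<le> measure ?\<Omega> (bad1 \<union> bad2) + measure ?\<Omega> N"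
    using bad1 bad2 N by (intro measure_Un_le) auto
  also have "measure ?\<Omega> (bad1 \<union> bad2) \<le> measure ?\<Omega> bad1 + measure ?\<Omega> bad2"
    using bad1 bad2 by (intro measure_Un_le) auto
  also have "measure ?\<Omega> N = 0" using N by (simp add: measure_def)
  finally have "measure ?\<Omega> (bad1 \<union> bad2 \<union> N) \<le> 2 * ?\<epsilon>" using bad1 bad2 by linarith
  moreover have "measure ?\<Omega> E = 1 - measure ?\<Omega> (bad1 \<union> bad2 \<union> N)"
    unfolding E_def using bad1 bad2 N by (intro prob_compl) auto
  moreover have "E \<in> sets ?\<Omega>" unfolding E_def using bad1 bad2 N by auto
  moreover have "?det w k \<noteq> 0" if "w \<in> E" "k < l" for w k
    using N_sub[of w k] matching[of w k] that unfolding E_def by blast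
  ultimately show ?thesis by (intro bexI[of _ E]) auto
qed

section \<open>Distribution of the sparse entries\<close>

lemma prob_space_Bern: "prob_space (Bern p)"
  unfolding Bern_def by (intro prob_space.prob_space_distr measure_pmf.prob_space_axioms) simp

lemma AE_Bern: "AE y in Bern p. y = 0 \<or> y = 1"
  unfolding Bern_def by (subst AE_distr_iff) auto

lemma measure_Bern_nonzero:
  assumes "0 \<le> p" "p \<le> 1"
  shows "measure (Bern p) {y. y \<noteq> 0} = p"
proof -
  have "measure (Bern p) {y. y \<noteq> 0} = measure (measure_pmf (bernoulli_pmf p)) {True}"
    unfolding Bern_def by (subst measure_distr) (auto intro!: arg_cong2[where f = measure])
  then show ?thesis using assms by (simp add: measure_pmf_single)
qed

text \<open>Where the mask is 0 the product is 0; where it is 1 the product follows the atomless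
  \<open>D\<close>. Hence \<open>0\<close> is the only possible atom, and its mass is that of a zero
  mask.\<close>

lemma sparse_entry_distribution:
  fixes D :: "real measure"
  assumes D: "prob_space D" "sets D = sets borel" "\<forall>x. measure D {x} = 0" and p: "0 \<le> p" "p \<le> 1"
  defines "M \<equiv> D \<Otimes>\<^sub>M Bern p" and "h \<equiv> \<lambda>x. fst x * snd x"
  shows "prob_space M" "h \<in> borel_measurable M"
    and "c \<noteq> 0 \<Longrightarrow> AE x in M. h x \<noteq> c"
    and "measure M {x \<in> space M. h x = 0} = 1 - p"
proof -
  interpret D: prob_space D by fact
  interpret B: prob_space "Bern p" by (rule prob_space_Bern)
  interpret pair_prob_space D "Bern p" ..
  have [measurable_cong]: "sets D = sets borel" "sets (Bern p) = sets borel"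
    using D by (simp_all add: Bern_def)
  have space: "space D = UNIV" "space (Bern p) = UNIV"
    using sets_eq_imp_space_eq[OF D(2)] by (simp_all add: Bern_def)
  show M: "prob_space M" unfolding M_def by (rule prob_space_axioms)
  show h [measurable]: "h \<in> borel_measurable M" unfolding h_def M_def by measurable
  have D_ne: "AE x in D. x \<noteq> c" for c
  proof (rule AE_I[of _ _ "{c}"])
    show "emeasure D {c} = 0" using D(3) by (simp add: D.emeasure_eq_measure)
  qed (use D(2) in auto)
  show "AE x in M. h x \<noteq> c" if "c \<noteq> 0"
    unfolding M_def h_def
  proof (rule AE_pair_measure)
    show "{x \<in> space (D \<Otimes>\<^sub>M Bern p). fst x * snd x \<noteq> c} \<in> sets (D \<Otimes>\<^sub>M Bern p)" by measurable
    show "AE x in D. AE y in Bern p. fst (x, y) * snd (x, y) \<noteq> c"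
      using D_ne[of c]
    proof eventually_elim
      case (elim x)
      show ?case using AE_Bern
        by eventually_elim (use elim that in auto)
    qed
  qed
  interpret M: prob_space M by (rule M)
  have "measure D {x. x \<noteq> 0} = 1"
    using D_ne[of 0] D.prob_eq_1[of "{x. x \<noteq> 0}"] D(2) by auto
  moreover have "{x \<in> space M. h x \<noteq> 0} = {x. x \<noteq> 0} \<times> {y. y \<noteq> 0}"
    by (auto simp: M_def h_def space_pair_measure space)
  moreover have "measure M ({x. x \<noteq> 0} \<times> {y. y \<noteq> 0}) = measure D {x. x \<noteq> 0} * measure (Bern p) {y. y \<noteq> 0}"
    unfolding M_def measure_def using D(2)
    by (subst B.emeasure_pair_measure_Times) (auto simp: Bern_def enn2real_mult)
  ultimately have "measure M {x \<in> space M. h x \<noteq> 0} = p"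
    using measure_Bern_nonzero[OF p] by simp
  moreover have "measure M {x \<in> space M. h x \<noteq> 0} = 1 - measure M {x \<in> space M. h x = 0}"
    by (rule M.prob_neg) measurable
  ultimately show "measure M {x \<in> space M. h x = 0} = 1 - p" by simp
qed

section \<open>Choice of constants and assembly\<close>

text \<open>Since \<open>ln d \<le> d\<close>, the ratio \<open>ln d / d\<close> is at most its
  square root, so \<open>p\<close> is at least \<open>2 * (a + 6) * (ln d / d)\<close>. The exponent
  \<open>a + 6\<close> is chosen to beat the union bound, which costs
  \<open>2 * l * d ^ 4\<close>.\<close>

lemma exp_rate_le:
  fixes a p :: real
  assumes d: "3 \<le> d" and a: "0 < a" and p: "2 * (a + 6) * sqrt (ln (real d) / real d) \<le> p"
  shows "exp (- p * d / 2) \<le> real d powr - (a + 6)"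
proof -
  have "0 \<le> ln (real d)" "ln (real d) \<le> real d" using d ln_bound[of "real d"] by auto
  then have "(ln (real d))\<^sup>2 \<le> ln (real d) * real d"
    unfolding power2_eq_square by (intro mult_left_mono) auto
  then have "(ln (real d) / real d)\<^sup>2 \<le> ln (real d) / real d"
    using d by (simp add: power_divide divide_simps power2_eq_square)
  then have "ln (real d) / real d \<le> sqrt (ln (real d) / real d)" by (rule real_le_rsqrt)
  then have "2 * (a + 6) * (ln (real d) / real d) \<le> p"
    using p a by (smt (verit) mult_left_mono)
  then have "(a + 6) * ln (real d) \<le> p * d / 2" using d by (simp add: field_simps)
  moreover have "- (a + 6) * ln (real d) = - ((a + 6) * ln (real d))" by (rule mult_minus_left)
  ultimately have "- p * d / 2 \<le> - (a + 6) * ln (real d)" by linarith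
  then have "exp (- p * d / 2) \<le> exp (- (a + 6) * ln (real d))" by (simp only: exp_le_cancel_iff)
  also have "\<dots> = real d powr - (a + 6)" using d by (simp add: powr_def)
  finally show ?thesis .
qed

theorem theorem3p3:
  fixes D :: "real measure"
  assumes "prob_space D"
    and "sets D = sets borel"
    and "\<forall>x. measure D {x} = 0"
    and "\<exists>B. AE x in D. \<bar>x\<bar> \<le> B"
  shows "\<forall>a>0. \<exists>C>0. \<exists>d0::nat. \<forall>d\<ge>d0. \<forall>(l::nat) (p::real).
     1 \<le> l \<and> real l \<le> real d powr a \<and> C * sqrt (ln (real d) / real d) \<le> p \<and> p \<le> 1 \<longrightarrow>
     (\<forall>Wt \<gamma>t \<beta>t. (\<forall>i\<in>{1..l}. opnorm_le1 d (Wt i)) \<longrightarrow>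
       (\<exists>E\<in>sets (Omega D d l p). measure (Omega D d l p) E \<ge> 1 - 1 / real d \<and>
          (\<forall>\<omega>\<in>E. \<exists>\<gamma> \<beta>. \<forall>x. (\<Sum>c<d. (x c)^2) \<le> 1 \<longrightarrow>
             (\<forall>r<d. netEval (recDim d) (Wrand \<omega>) \<gamma> \<beta> (2 * l) x r
                    = netEval (\<lambda>_. d) Wt \<gamma>t \<beta>t l x r))))"
proof (intro allI impI)
  fix a :: real assume a: "a > 0"
  \<comment> \<open>The witnesses are \<open>C = 2 * (a + 6)\<close> and
    \<open>d0 = 3\<close>.\<close>
  have main: "\<exists>E\<in>sets (Omega D d l p). measure (Omega D d l p) E \<ge> 1 - 1 / real d \<and>
          (\<forall>\<omega>\<in>E. \<exists>\<gamma> \<beta>. \<forall>x. (\<Sum>c<d. (x c)^2) \<le> 1 \<longrightarrow>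
             (\<forall>r<d. netEval (recDim d) (Wrand \<omega>) \<gamma> \<beta> (2 * l) x r
                    = netEval (\<lambda>_. d) Wt \<gamma>t \<beta>t l x r))"
    if d: "3 \<le> d" and l: "real l \<le> real d powr a"
      and p: "2 * (a + 6) * sqrt (ln (real d) / real d) \<le> p" "p \<le> 1" for d l p Wt \<gamma>t \<beta>t
  proof -
    let ?h = "\<lambda>x::real \<times> real. fst x * snd x"
    let ?x = "exp (- p * d / 2)"
    have "0 \<le> 2 * (a + 6) * sqrt (ln (real d) / real d)" using d a by simp
    then have p0: "0 \<le> p" using p(1) by linarith
    note M = sparse_entry_distribution[OF assms(1-3) p0 p(2)]
    have x: "?x \<le> real d powr - (a + 6)" by (rule exp_rate_le[OF d a p(1)])
    have d_powr: "real d ^ n = real d powr n" for n using d by (simp add: powr_realpow)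
    have "(real d)\<^sup>2 * ?x \<le> real d powr 2 * real d powr - (a + 6)"
      using x d_powr[of 2] by (intro mult_mono) auto
    also have "\<dots> \<le> real d powr 0"
      unfolding powr_add[symmetric] using d a by (intro powr_mono) auto
    finally have small: "(real d)\<^sup>2 * ?x \<le> 1" using d by simp
    have exponent: "a + 4 + - (a + 6) = - 2" by simp
    have "2 * real l * real d ^ 4 * ?x \<le> 2 * real d powr a * real d powr 4 * real d powr - (a + 6)"
      using l x d_powr[of 4] by (intro mult_mono) auto
    also have "\<dots> = 2 * real d powr (a + 4 + - (a + 6))"
      by (simp only: powr_add mult.assoc)
    \<comment> \<open>The remaining decay is quadratic: one factor \<open>1 / d\<close> is the
      claimed failure probability, the other absorbs the constant 2.\<close>
    also have "\<dots> = 2 / real d * (1 / real d)"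
      unfolding exponent using d by (simp add: powr_minus powr_numeral power2_eq_square field_simps)
    also have "\<dots> \<le> 1 * (1 / real d)" using d by (intro mult_right_mono) auto
    finally have small': "2 * real l * real d ^ 4 * ?x \<le> 1 / real d" by simp
    \<comment> \<open>An entry vanishes with probability \<open>1 - p \<le> exp (- p)\<close>, so
      the rate \<open>t\<close> of the matching estimates is \<open>p\<close> itself.\<close>
    have q: "measure (D \<Otimes>\<^sub>M Bern p) {x \<in> space (D \<Otimes>\<^sub>M Bern p). ?h x = 0} \<le> exp (- p)"
      using M(4) exp_ge_add_one_self[of "- p"] by simp
    have "\<exists>E\<in>sets (Omega D d l p).
        measure (Omega D d l p) E \<ge> 1 - 2 * real l * real d ^ 4 * ?x \<and>
        (\<forall>\<omega>\<in>E. \<forall>k<l. det (mat (d\<^sup>2) (d\<^sup>2) (\<lambda>(n, m).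
          Wrand \<omega> (2 * k + 2) (n div d) m * Wrand \<omega> (2 * k + 1) m (n mod d))) \<noteq> 0)"
      unfolding Omega_def Wrand_def by (rule good_event[OF M(1,2) _ q p0 small]) (rule M(3))
    then obtain E where E: "E \<in> sets (Omega D d l p)"
        "measure (Omega D d l p) E \<ge> 1 - 2 * real l * real d ^ 4 * ?x"
      and det: "\<And>\<omega> k. \<omega> \<in> E \<Longrightarrow> k < l \<Longrightarrow> det (mat (d\<^sup>2) (d\<^sup>2) (\<lambda>(n, m).
          Wrand \<omega> (2 * k + 2) (n div d) m * Wrand \<omega> (2 * k + 1) m (n mod d))) \<noteq> 0"
      by blast
    have "\<exists>\<gamma> \<beta>. \<forall>x. (\<Sum>c<d. (x c)^2) \<le> 1 \<longrightarrow>
             (\<forall>r<d. netEval (recDim d) (Wrand \<omega>) \<gamma> \<beta> (2 * l) x r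
                    = netEval (\<lambda>_. d) Wt \<gamma>t \<beta>t l x r)" if \<omega>: "\<omega> \<in> E" for \<omega>
    proof (rule reconstruction)
      fix k assume "k < l"
      \<comment> \<open>The unknown is the diagonal of the odd layer's scale; flattening positions
        by \<open>n = i * d + j\<close> turns the matrix equation into a square system of size
        \<open>d\<^sup>2\<close>.\<close>
      from linear_system_solvable[OF det[OF \<omega> this], of "\<lambda>n. Wt (Suc k) (n div d) (n mod d)"]
      obtain g where g: "\<And>n. n < d\<^sup>2 \<Longrightarrow> (\<Sum>m<d\<^sup>2. Wrand \<omega> (2 * k + 2) (n div d) m *
          Wrand \<omega> (2 * k + 1) m (n mod d) * g m) = Wt (Suc k) (n div d) (n mod d)"
        by blast
      have "(\<Sum>m<d\<^sup>2. Wrand \<omega> (2 * k + 2) i m * g m * Wrand \<omega> (2 * k + 1) m j) = Wt (Suc k) i j"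
        if "i < d" "j < d" for i j
        using g[OF block_index_less[OF that]] that by (simp add: mult_ac)
      then show "\<exists>g. \<forall>i<d. \<forall>j<d. (\<Sum>m<d\<^sup>2. Wrand \<omega> (2 * k + 2) i m * g m *
          Wrand \<omega> (2 * k + 1) m j) = Wt (Suc k) i j" by blast
    qed
    then show ?thesis using E small' by (intro bexI[of _ E]) auto
  qed
  have "2 * (a + 6) > 0" using a by simp
  then show "\<exists>C>0. \<exists>d0::nat. \<forall>d\<ge>d0. \<forall>(l::nat) (p::real).
     1 \<le> l \<and> real l \<le> real d powr a \<and> C * sqrt (ln (real d) / real d) \<le> p \<and> p \<le> 1 \<longrightarrow>
     (\<forall>Wt \<gamma>t \<beta>t. (\<forall>i\<in>{1..l}. opnorm_le1 d (Wt i)) \<longrightarrow>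
       (\<exists>E\<in>sets (Omega D d l p). measure (Omega D d l p) E \<ge> 1 - 1 / real d \<and>
          (\<forall>\<omega>\<in>E. \<exists>\<gamma> \<beta>. \<forall>x. (\<Sum>c<d. (x c)^2) \<le> 1 \<longrightarrow>
             (\<forall>r<d. netEval (recDim d) (Wrand \<omega>) \<gamma> \<beta> (2 * l) x r
                    = netEval (\<lambda>_. d) Wt \<gamma>t \<beta>t l x r))))"
    using main by blast
qed

end
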